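(* Let $K\in(0,\infty)$ and let $\mathcal{T}(K)$ be the set of $K$-exceptional times in $[0,\infty)$. Almost surely, $\dim_H(\mathcal{T}(K))\le 1-p(K)$, where $p(K)\in(0,1)$ is the solution of the equation $$f(p,K)\equiv\frac{\sin(\pi p/2)\,\Gamma(1+p/2)}{\pi}\sum_{n=1}^\infty\frac{(\sqrt{2}K)^n}{n!}\,\Gamma((n-p)/2)=1.$$ Furthermore, $K\mapsto p(K)$ is a continuous decreasing function on $(0,\infty)$ with $\lim_{K\to\infty}p(K)=0$ and $\lim_{K\downarrow 0}p(K)=1$.
   Context: Let $\mathbb{Z}^2_{even}=\{(x,t)\in\mathbb{Z}^2: x+t \text{ is even}\}$. Dynamical discrete web: the processes $(\xi_z^\tau)_{\tau\ge 0}$, $z\in\mathbb{Z}^2_{even}$, are independent, right-continuous, $\{-1,+1\}$-valued; for each $z$, $\xi_z^0$ is uniform on $\{-1,+1\}$, and at each ring of a rate-one Poisson clock at $z$ the value is replaced by a fresh independent uniform $\{-1,+1\}$ value. For each $\tau\geq 0$, $S_0^\tau$ is the path with $S_0^\tau(0)=0$, $S_0^\tau(t+1)=S_0^\tau(t)+\xi^\tau_{(S_0^\tau(t),t)}$ for integers $t\ge 0$, linearly interpolated between integer times. $K$-exceptional times: $\mathcal{T}(K)=\{\tau\in[0,\infty): S_0^\tau(t)\ge -K\sqrt{t}\ \text{ for all } t\ge 0\}$. $\dim_H$ is Hausdorff dimension; $\dim_H(\mathcal{T}(K))$ is almost surely equal to a deterministic constant. *)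

theory Defs
  imports "HOL-Probability.Probability"
begin

subsection \<open>Hausdorff dimension\<close>

text \<open>The covering sets are required to be bounded because \<^const>\<open>diameter\<close> is unspecified on
  unbounded sets. Finite covers are included: \<open>U i\<close> may be empty, and then it contributes
  \<open>0 powr s = 0\<close>.\<close>

definition hausdorff_content :: "real \<Rightarrow> real \<Rightarrow> 'a::metric_space set \<Rightarrow> ennreal" where
  "hausdorff_content s \<delta> A =
     (INF U \<in> {U :: nat \<Rightarrow> 'a set. A \<subseteq> (\<Union>i. U i) \<and> (\<forall>i. bounded (U i) \<and> diameter (U i) \<le> \<delta>)}.
        \<Sum>i. ennreal (diameter (U i) powr s))"

definition hausdorff_measure :: "real \<Rightarrow> 'a::metric_space set \<Rightarrow> ennreal" where
  "hausdorff_measure s A = (SUP \<delta> \<in> {0<..}. hausdorff_content s \<delta> A)"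

text \<open>The infimum runs over \<open>s > 0\<close> only, which gives the same value as \<open>s \<ge> 0\<close> and avoids the
  convention \<open>0 powr 0 = 0\<close>. In particular the empty set has dimension \<open>0\<close>.\<close>

definition hausdorff_dim :: "'a::metric_space set \<Rightarrow> ereal" where
  "hausdorff_dim A = (INF s \<in> {s. 0 < s \<and> hausdorff_measure s A = 0}. ereal s)"


subsection \<open>The dynamical discrete web\<close>

definition Z2even :: "(int \<times> int) set" where
  "Z2even = {(x, t). even (x + t)}"

text \<open>A clock is given by the successive waiting times \<open>g 0, g 1, \<dots>\<close> between its rings; the
  \<open>n\<close>-th ring, \<open>n \<ge> 1\<close>, happens at time \<open>g 0 + \<dots> + g (n - 1)\<close>. For exponential waiting times the
  set below is almost surely finite for every \<open>\<tau>\<close>, so \<^const>\<open>card\<close> is the actual number of rings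
  up to and including time \<open>\<tau>\<close>.\<close>

definition ring_count :: "(nat \<Rightarrow> real) \<Rightarrow> real \<Rightarrow> nat" where
  "ring_count g \<tau> = card {n. 1 \<le> n \<and> (\<Sum>k<n. g k) \<le> \<tau>}"

text \<open>\<open>coin z 0\<close> is the initial value at site \<open>z\<close> and \<open>coin z n\<close>, \<open>n \<ge> 1\<close>, the fresh value taken
  at the \<open>n\<close>-th ring of the clock at \<open>z\<close>; \<open>gap z\<close> are the waiting times of that clock.\<close>

locale dynamical_discrete_web = prob_space M
  for M :: "'w measure" +
  fixes coin :: "int \<times> int \<Rightarrow> nat \<Rightarrow> 'w \<Rightarrow> int"
    and gap :: "int \<times> int \<Rightarrow> nat \<Rightarrow> 'w \<Rightarrow> real"
  assumes indep: "indep_vars (\<lambda>_. borel)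
      (case_sum (\<lambda>(z, n) \<omega>. real_of_int (coin z n \<omega>)) (\<lambda>(z, n). gap z n))
      ((Z2even \<times> UNIV) <+> (Z2even \<times> UNIV))"
    and coin_values: "z \<in> Z2even \<Longrightarrow> \<omega> \<in> space M \<Longrightarrow> coin z n \<omega> \<in> {-1, 1}"
    and coin_law: "z \<in> Z2even \<Longrightarrow>
      distr M (count_space UNIV) (coin z n) = measure_pmf (pmf_of_set {-1, 1})"
    and gap_law: "z \<in> Z2even \<Longrightarrow> distributed M lborel (gap z n) (exponential_density 1)"

definition web_xi ::
  "(int \<times> int \<Rightarrow> nat \<Rightarrow> 'w \<Rightarrow> int) \<Rightarrow> (int \<times> int \<Rightarrow> nat \<Rightarrow> 'w \<Rightarrow> real)
    \<Rightarrow> real \<Rightarrow> 'w \<Rightarrow> int \<times> int \<Rightarrow> int" where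
  "web_xi coin gap \<tau> \<omega> z = coin z (ring_count (\<lambda>k. gap z k \<omega>) \<tau>) \<omega>"

text \<open>The path from the origin driven by a configuration \<open>\<eta>\<close> of \<open>\<plusminus>1\<close> arrows, first at integer
  times and then linearly interpolated.\<close>

primrec walk :: "(int \<times> int \<Rightarrow> int) \<Rightarrow> nat \<Rightarrow> int" where
  "walk \<eta> 0 = 0"
| "walk \<eta> (Suc t) = walk \<eta> t + \<eta> (walk \<eta> t, int t)"

definition walk_path :: "(int \<times> int \<Rightarrow> int) \<Rightarrow> real \<Rightarrow> real" where
  "walk_path \<eta> t = (let n = nat \<lfloor>t\<rfloor> in
     (1 - frac t) * real_of_int (walk \<eta> n) + frac t * real_of_int (walk \<eta> (Suc n)))"

definition exceptional_times ::
  "(int \<times> int \<Rightarrow> nat \<Rightarrow> 'w \<Rightarrow> int) \<Rightarrow> (int \<times> int \<Rightarrow> nat \<Rightarrow> 'w \<Rightarrow> real)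
    \<Rightarrow> real \<Rightarrow> 'w \<Rightarrow> real set" where
  "exceptional_times coin gap K \<omega> =
     {\<tau>. 0 \<le> \<tau> \<and> (\<forall>t\<ge>0. - K * sqrt t \<le> walk_path (web_xi coin gap \<tau> \<omega>) t)}"


subsection \<open>The exponent\<close>

definition exponent_fun :: "real \<Rightarrow> real \<Rightarrow> real" where
  "exponent_fun p K =
     sin (pi * p / 2) * Gamma (1 + p / 2) / pi *
     (\<Sum>m. let n = Suc m in (sqrt 2 * K) ^ n / fact n * Gamma ((real n - p) / 2))"

definition exponent :: "real \<Rightarrow> real" where
  "exponent K = (THE p. p \<in> {0<..<1} \<and> exponent_fun p K = 1)"

end

theory Submission
  imports Defs "HOL-Real_Asymp.Real_Asymp"
begin

text \<open>Write \<open>q = p / 2\<close> and \<open>\<kappa> = sqrt 2 * K\<close>. The function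
  \<open>u(x, t) = \<integral> (1 - exp (- y x - y\<^sup>2 t / 2)) y powr (- p - 1) dy\<close> (over \<open>y > 0\<close>) is a mixture of the
  exponential martingales of Brownian motion \<open>B\<close>, so \<open>u(B\<^sub>t, t)\<close> is a martingale, and Brownian
  scaling gives \<open>u(x, t) = t powr q * u(x / sqrt t, 1)\<close>. It increases in \<open>x\<close>. If \<open>u(- K, 1) = 0\<close>,
  then \<open>u\<close> vanishes on the parabola \<open>x = - K sqrt t\<close> and is positive above it, so Brownian motion
  stays above the parabola up to time \<open>t\<close> with probability of order \<open>t powr (- p / 2)\<close>. The
  substitution \<open>y = sqrt (2 t)\<close> turns \<open>u(- K, 1)\<close>, up to a positive factor, into the integral
  \<open>profile q \<kappa>\<close>; expanding it in powers of \<open>\<kappa>\<close> and integrating term by term shows that it vanishes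
  exactly when \<open>exponent_fun p K = 1\<close> (\<open>exponent_fun_eq_profile\<close>).

  The claims about the exponent are statements about the sign of \<open>profile q \<kappa>\<close>. Its integrand has
  the sign of \<open>t - \<kappa>\<^sup>2\<close>, which makes \<open>\<kappa>\<^sup>2 powr q * profile q \<kappa>\<close> strictly decreasing in \<open>q\<close> and
  gives uniqueness of the zero. In \<open>\<kappa>\<close> the integral is strictly decreasing, hence so is the
  exponent in \<open>K\<close>. Continuity in either variable follows from convexity of the \<open>\<kappa>\<close>-dependent part.

  For the dimension, consider the dynamical times in an interval \<open>[a, a + e]\<close>. Every path
  \<open>S\<^sub>0\<^sup>\<tau>\<close> with \<open>\<tau>\<close> in it stays below the path that goes right at each site whose arrow points
  right at time \<open>a\<close> or whose clock rings in \<open>(a, a + e]\<close> (\<open>exceptional_time_stays_above\<close>). The steps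
  of that path are independent with drift at most \<open>2 e\<close>, and such a drift is not felt before time
  of order \<open>1 / e\<^sup>2\<close>. For each \<open>p < exponent K\<close> one has \<open>u(- K, 1) > 0\<close>, which leaves room for the
  drift and the lattice, and a discrete version of \<open>u\<close> bounds the probability that the interval
  contains an exceptional time by a constant times \<open>e powr p\<close>
  (\<open>prob_exceptional_time_in_interval_le\<close>). Covering \<open>[0, \<infinity>)\<close> with such intervals shows that the
  \<open>s\<close>-dimensional Hausdorff measure vanishes almost surely whenever \<open>p + s > 1\<close>
  (\<open>AE_hausdorff_measure_eq_0\<close>).\<close>

section \<open>Gamma integrals and the excess integral\<close>

lemma set_lborel_of_has_integral:
  fixes f :: "real \<Rightarrow> real"
  assumes f: "(f has_integral I) S" and nonneg: "\<And>x. x \<in> S \<Longrightarrow> 0 \<le> f x"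
    and [measurable]: "f \<in> borel_measurable borel" "S \<in> sets borel"
  shows "set_integrable lborel S f" "(LINT x:S|lborel. f x) = I"
proof -
  have "0 \<le> I" using has_integral_nonneg[OF f nonneg] .
  with nn_integral_has_integral_lebesgue[OF nonneg f]
  have "has_bochner_integral lborel (\<lambda>x. indicator S x * f x) I"
    by (intro has_bochner_integral_nn_integral) (auto simp: indicator_def nonneg)
  then show "set_integrable lborel S f" "(LINT x:S|lborel. f x) = I"
    by (auto simp: set_integrable_def set_lebesgue_integral_def has_bochner_integral_iff)
qed

lemma set_integral_Gamma:
  assumes "0 < (x :: real)"
  shows "set_integrable lborel {0<..} (\<lambda>t. t powr (x - 1) * exp (- t))"
    and "(LINT t:{0<..}|lborel. t powr (x - 1) * exp (- t)) = Gamma x"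
proof -
  have "((\<lambda>t. t powr (x - 1) / exp t) has_integral Gamma x) {0<..}"
    using Gamma_integral_real[OF assms]
    by (subst has_integral_spike_set_eq[where T = "{0..}"])
       (auto intro: negligible_subset[of "{0}"])
  then have "((\<lambda>t. t powr (x - 1) * exp (- t)) has_integral Gamma x) {0<..}"
    by (simp add: exp_minus divide_simps)
  from set_lborel_of_has_integral[OF this]
  show "set_integrable lborel {0<..} (\<lambda>t. t powr (x - 1) * exp (- t))"
    and "(LINT t:{0<..}|lborel. t powr (x - 1) * exp (- t)) = Gamma x"
    by auto
qed

definition excess_kernel :: "real \<Rightarrow> real \<Rightarrow> real \<Rightarrow> real" where
  "excess_kernel q \<kappa> t = (exp (\<kappa> * sqrt t) - 1) * exp (- t) * t powr (- q - 1)"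

text \<open>The part of the profile integral that depends on \<open>\<kappa>\<close>. Unlike the profile itself it also makes
  sense for \<open>q \<le> 0\<close>, so that it is continuous up to \<open>q = 0\<close>.\<close>

definition excess_integral :: "real \<Rightarrow> real \<Rightarrow> real" where
  "excess_integral q \<kappa> = (LINT t:{0<..}|lborel. excess_kernel q \<kappa> t)"

lemma excess_kernel_measurable [measurable]: "excess_kernel q \<kappa> \<in> borel_measurable borel"
  unfolding excess_kernel_def by measurable

lemma abs_exp_minus_one_le: "\<bar>exp y - 1\<bar> \<le> \<bar>y\<bar> * exp \<bar>y\<bar>" for y :: real
proof (cases "0 \<le> y")
  case True
  have "1 - y \<le> exp (- y)" using exp_ge_add_one_self[of "-y"] by simp
  then have "exp y * (1 - y) \<le> exp y * exp (- y)" by simp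
  then show ?thesis using True by (simp add: exp_minus algebra_simps)
next
  case False
  have "\<bar>y\<bar> * 1 \<le> \<bar>y\<bar> * exp \<bar>y\<bar>" by (intro mult_left_mono) auto
  moreover have "exp y \<le> 1" "1 + y \<le> exp y" using False exp_ge_add_one_self[of y] by simp_all
  ultimately show ?thesis by linarith
qed

text \<open>Near \<open>0\<close> the factor \<open>exp (\<kappa> * sqrt t) - 1\<close> gains \<open>sqrt t\<close>, which is why \<open>q < 1/2\<close> suffices; at
  infinity \<open>\<kappa> * sqrt t \<le> \<kappa>\<^sup>2 / 2 + t / 2\<close> costs half of the decay of \<open>exp (- t)\<close>. The resulting bound is a
  rescaled Gamma integrand.\<close>

lemma excess_kernel_integrable:
  assumes "q < 1/2"
  shows "set_integrable lborel {0<..} (excess_kernel q \<kappa>)"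
proof -
  let ?a = "1/2 - q"
  have "integrable lborel (\<lambda>t. indicator {0<..} (0 + (1/2) * t) *\<^sub>R ((0 + (1/2) * t) powr (?a - 1) * exp (- (0 + (1/2) * t))))"
    by (rule lborel_integrable_real_affine)
       (use set_integral_Gamma(1)[of ?a] assms in \<open>auto simp: set_integrable_def\<close>)
  then have "integrable lborel (\<lambda>t. (2 powr (?a - 1)) * (indicator {0<..} (0 + (1/2) * t) *\<^sub>R ((0 + (1/2) * t) powr (?a - 1) * exp (- (0 + (1/2) * t)))))"
    by simp
  also have "(\<lambda>t. (2 powr (?a - 1)) * (indicator {0<..} (0 + (1/2) * t) *\<^sub>R ((0 + (1/2) * t) powr (?a - 1) * exp (- (0 + (1/2) * t)))))
     = (\<lambda>t. indicator {0<..} t *\<^sub>R (t powr (?a - 1) * exp (- (t/2))))"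
    by (auto simp: indicator_def powr_divide fun_eq_iff)
  finally have "set_integrable lborel {0<..} (\<lambda>t. t powr (?a - 1) * exp (- (t/2)))"
    by (simp add: set_integrable_def)
  then have int: "set_integrable lborel {0<..} (\<lambda>t. (\<bar>\<kappa>\<bar> * exp (\<kappa>\<^sup>2/2)) * (t powr (?a - 1) * exp (- (t/2))))"
    by simp
  show ?thesis
  proof (rule set_integrable_bound[OF int])
    show "set_borel_measurable lborel {0<..} (excess_kernel q \<kappa>)"
      unfolding set_borel_measurable_def by measurable
    have "norm (excess_kernel q \<kappa> t) \<le> (\<bar>\<kappa>\<bar> * exp (\<kappa>\<^sup>2/2)) * (t powr (?a - 1) * exp (- (t/2)))" if "0 < t" for t
    proof -
      have "\<bar>\<kappa>\<bar> * sqrt t \<le> \<kappa>\<^sup>2/2 + t/2"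
        using sum_squares_bound[of "\<bar>\<kappa>\<bar>" "sqrt t"] that by simp
      then have e: "exp \<bar>\<kappa> * sqrt t\<bar> \<le> exp (\<kappa>\<^sup>2/2 + t/2)"
        using that by (simp add: abs_mult)
      have "\<bar>exp (\<kappa> * sqrt t) - 1\<bar> \<le> \<bar>\<kappa> * sqrt t\<bar> * exp \<bar>\<kappa> * sqrt t\<bar>"
        by (rule abs_exp_minus_one_le)
      also have "\<dots> \<le> \<bar>\<kappa> * sqrt t\<bar> * exp (\<kappa>\<^sup>2/2 + t/2)"
        by (intro mult_left_mono e) auto
      finally have *: "\<bar>exp (\<kappa> * sqrt t) - 1\<bar> \<le> \<bar>\<kappa>\<bar> * t powr (1/2) * exp (\<kappa>\<^sup>2/2 + t/2)"
        using that by (simp add: abs_mult powr_half_sqrt)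
      have "norm (excess_kernel q \<kappa> t) = \<bar>exp (\<kappa> * sqrt t) - 1\<bar> * (exp (- t) * t powr (- q - 1))"
        by (simp add: excess_kernel_def abs_mult)
      also have "\<dots> \<le> \<bar>\<kappa>\<bar> * t powr (1/2) * exp (\<kappa>\<^sup>2/2 + t/2) * (exp (- t) * t powr (- q - 1))"
        by (intro mult_right_mono *) auto
      also have "\<dots> = \<bar>\<kappa>\<bar> * (t powr (1/2) * t powr (- q - 1)) * (exp (\<kappa>\<^sup>2/2 + t/2) * exp (- t))"
        by simp
      also have "t powr (1/2) * t powr (- q - 1) = t powr (?a - 1)"
        by (simp add: powr_add[symmetric])
      also have "exp (\<kappa>\<^sup>2/2 + t/2) * exp (- t) = exp (\<kappa>\<^sup>2/2) * exp (- (t/2))"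
        by (simp add: exp_add[symmetric])
      finally show ?thesis by (simp add: mult_ac)
    qed
    then show "AE t in lborel. t \<in> {0<..} \<longrightarrow> norm (excess_kernel q \<kappa> t) \<le> norm ((\<bar>\<kappa>\<bar> * exp (\<kappa>\<^sup>2/2)) * (t powr (?a - 1) * exp (- (t/2))))"
      by (auto simp: abs_mult intro!: AE_I2)
  qed
qed

text \<open>Convexity of the exponential function under the integral. Together with the next lemma it yields
  continuity in each variable, since a convex function on an open interval is continuous.\<close>

lemma excess_integral_convex_kappa:
  assumes "q < 1/2"
  shows "convex_on UNIV (excess_integral q)"
proof (rule convex_onI)
  fix s x y :: real assume s: "0 < s" "s < 1"
  have "excess_integral q ((1 - s) *\<^sub>R x + s *\<^sub>R y) \<le> (LINT t:{0<..}|lborel. (1 - s) * excess_kernel q x t + s * excess_kernel q y t)"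
    unfolding excess_integral_def
  proof (intro set_integral_mono)
    fix t :: real
    have "exp ((1 - s) *\<^sub>R (x * sqrt t) + s *\<^sub>R (y * sqrt t)) \<le> (1 - s) * exp (x * sqrt t) + s * exp (y * sqrt t)"
      by (rule convex_onD[OF exp_convex]) (use s in auto)
    then have "exp (((1 - s) *\<^sub>R x + s *\<^sub>R y) * sqrt t) - 1 \<le> (1 - s) * (exp (x * sqrt t) - 1) + s * (exp (y * sqrt t) - 1)"
      by (simp add: algebra_simps)
    then have "(exp (((1 - s) *\<^sub>R x + s *\<^sub>R y) * sqrt t) - 1) * (exp (- t) * t powr (- q - 1))
       \<le> ((1 - s) * (exp (x * sqrt t) - 1) + s * (exp (y * sqrt t) - 1)) * (exp (- t) * t powr (- q - 1))"
      by (intro mult_right_mono) auto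
    then show "excess_kernel q ((1 - s) *\<^sub>R x + s *\<^sub>R y) t \<le> (1 - s) * excess_kernel q x t + s * excess_kernel q y t"
      by (simp add: excess_kernel_def algebra_simps)
  qed (use excess_kernel_integrable[OF assms] in auto)
  also have "\<dots> = (1 - s) * excess_integral q x + s * excess_integral q y"
    using excess_kernel_integrable[OF assms] by (simp add: set_integral_add excess_integral_def)
  finally show "excess_integral q ((1 - s) *\<^sub>R x + s *\<^sub>R y) \<le> (1 - s) * excess_integral q x + s * excess_integral q y" .
qed auto

lemma excess_integral_convex_q:
  assumes "0 \<le> \<kappa>"
  shows "convex_on {..<1/2} (\<lambda>q. excess_integral q \<kappa>)"
proof (rule convex_onI)
  fix s x y :: real assume s: "0 < s" "s < 1" and xy: "x \<in> {..<1/2}" "y \<in> {..<1/2}"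
  have xy': "(1 - s) *\<^sub>R x + s *\<^sub>R y < 1/2"
    using convexD_alt[OF convex_real_interval(4)[of "1/2"] xy, of s] s by simp
  have "excess_integral ((1 - s) *\<^sub>R x + s *\<^sub>R y) \<kappa> \<le> (LINT t:{0<..}|lborel. (1 - s) * excess_kernel x \<kappa> t + s * excess_kernel y \<kappa> t)"
    unfolding excess_integral_def
  proof (intro set_integral_mono)
    fix t :: real assume t: "t \<in> {0<..}"
    have "exp ((1 - s) *\<^sub>R ((- x - 1) * ln t) + s *\<^sub>R ((- y - 1) * ln t)) \<le> (1 - s) * exp ((- x - 1) * ln t) + s * exp ((- y - 1) * ln t)"
      by (rule convex_onD[OF exp_convex]) (use s in auto)
    then have "t powr (- ((1 - s) *\<^sub>R x + s *\<^sub>R y) - 1) \<le> (1 - s) * t powr (- x - 1) + s * t powr (- y - 1)"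
      using t by (simp add: powr_def algebra_simps)
    moreover have "0 \<le> exp (\<kappa> * sqrt t) - 1" using assms t by simp
    ultimately have "((exp (\<kappa> * sqrt t) - 1) * exp (- t)) * t powr (- ((1 - s) *\<^sub>R x + s *\<^sub>R y) - 1)
       \<le> ((exp (\<kappa> * sqrt t) - 1) * exp (- t)) * ((1 - s) * t powr (- x - 1) + s * t powr (- y - 1))"
      by (intro mult_left_mono) auto
    then show "excess_kernel ((1 - s) *\<^sub>R x + s *\<^sub>R y) \<kappa> t \<le> (1 - s) * excess_kernel x \<kappa> t + s * excess_kernel y \<kappa> t"
      by (simp add: excess_kernel_def algebra_simps)
  qed (use excess_kernel_integrable xy xy' in auto)
  also have "\<dots> = (1 - s) * excess_integral x \<kappa> + s * excess_integral y \<kappa>"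
    using excess_kernel_integrable xy by (simp add: set_integral_add excess_integral_def)
  finally show "excess_integral ((1 - s) *\<^sub>R x + s *\<^sub>R y) \<kappa> \<le> (1 - s) * excess_integral x \<kappa> + s * excess_integral y \<kappa>" .
qed auto

lemma excess_integral_continuous_kappa: "q < 1/2 \<Longrightarrow> continuous_on UNIV (excess_integral q)"
  by (intro convex_on_continuous excess_integral_convex_kappa) auto

lemma excess_integral_continuous_q: "0 \<le> \<kappa> \<Longrightarrow> continuous_on {..<1/2} (\<lambda>q. excess_integral q \<kappa>)"
  by (intro convex_on_continuous excess_integral_convex_q) auto

text \<open>Expanding \<open>exp (\<kappa> * sqrt t)\<close> leaves Gamma integrals; all terms are nonnegative, so the integrable
  sum dominates the partial sums.\<close>

lemma excess_integral_sums:
  assumes "q < 1/2" "0 \<le> \<kappa>"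
  shows "(\<lambda>m. \<kappa> ^ Suc m / fact (Suc m) * Gamma (real (Suc m) / 2 - q)) sums excess_integral q \<kappa>"
proof -
  define g where "g m t = indicator {0<..} t * (\<kappa> ^ Suc m / fact (Suc m) * (t powr ((real (Suc m) / 2 - q) - 1) * exp (- t)))" for m and t :: real
  have g_int: "has_bochner_integral lborel (g m) (\<kappa> ^ Suc m / fact (Suc m) * Gamma (real (Suc m) / 2 - q))" for m
  proof -
    have "0 < real (Suc m) / 2 - q" using assms by (simp add: field_simps)
    from set_integral_Gamma[OF this] have "has_bochner_integral lborel (\<lambda>t. indicator {0<..} t * (t powr ((real (Suc m) / 2 - q) - 1) * exp (- t))) (Gamma (real (Suc m) / 2 - q))"
      by (simp add: has_bochner_integral_iff set_integrable_def set_lebesgue_integral_def)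
    from has_bochner_integral_mult_right[OF this, of "\<kappa> ^ Suc m / fact (Suc m)"] show ?thesis
      by (simp add: g_def[abs_def] mult_ac)
  qed
  have g_nonneg: "0 \<le> g m t" for m t
    using assms by (auto simp: g_def)
  have g_sums: "(\<lambda>m. g m t) sums (indicator {0<..} t * excess_kernel q \<kappa> t)" for t
  proof (cases "0 < t")
    case True
    have "(\<lambda>n. (\<kappa> * sqrt t) ^ n /\<^sub>R fact n) sums exp (\<kappa> * sqrt t)"
      by (rule exp_converges)
    then have "(\<lambda>n. (\<kappa> * sqrt t) ^ n / fact n) sums exp (\<kappa> * sqrt t)"
      by (simp add: divide_inverse mult.commute)
    then have "(\<lambda>m. (\<kappa> * sqrt t) ^ Suc m / fact (Suc m)) sums (exp (\<kappa> * sqrt t) - 1)"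
      by (subst sums_Suc_iff) simp
    then have "(\<lambda>m. (\<kappa> * sqrt t) ^ Suc m / fact (Suc m) * (exp (- t) * t powr (- q - 1))) sums ((exp (\<kappa> * sqrt t) - 1) * (exp (- t) * t powr (- q - 1)))"
      by (rule sums_mult2)
    also have "(\<lambda>m. (\<kappa> * sqrt t) ^ Suc m / fact (Suc m) * (exp (- t) * t powr (- q - 1))) = (\<lambda>m. g m t)"
    proof
      fix m
      have "(sqrt t) ^ Suc m * t powr (- q - 1) = t powr ((real (Suc m) / 2 - q) - 1)"
        using True by (simp add: powr_half_sqrt[symmetric] powr_realpow[symmetric] powr_powr powr_add[symmetric] algebra_simps del: power_Suc)
      then show "(\<kappa> * sqrt t) ^ Suc m / fact (Suc m) * (exp (- t) * t powr (- q - 1)) = g m t"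
        using True by (simp add: g_def power_mult_distrib mult_ac del: power_Suc fact_Suc)
    qed
    finally show ?thesis using True by (simp add: excess_kernel_def mult_ac)
  qed (simp add: g_def)
  have int_excess: "integrable lborel (\<lambda>t. indicator {0<..} t * excess_kernel q \<kappa> t)"
    using excess_kernel_integrable[OF assms(1)] by (simp add: set_integrable_def)
  have norm_g: "norm (g m t) = g m t" for m t using g_nonneg by simp
  have int_g: "integrable lborel (g m)" for m using g_int by (simp add: has_bochner_integral_iff)
  have "summable (\<lambda>m. \<integral>t. norm (g m t) \<partial>lborel)"
  proof (rule summableI_nonneg_bounded)
    fix n
    have "(\<Sum>m<n. \<integral>t. norm (g m t) \<partial>lborel) = (\<integral>t. (\<Sum>m<n. g m t) \<partial>lborel)"
      using int_g by (simp only: norm_g Bochner_Integration.integral_sum)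
    also have "\<dots> \<le> (\<integral>t. indicator {0<..} t * excess_kernel q \<kappa> t \<partial>lborel)"
    proof (rule integral_mono)
      show "(\<Sum>m<n. g m t) \<le> indicator {0<..} t * excess_kernel q \<kappa> t" for t
        using sum_le_suminf[OF sums_summable[OF g_sums], of "{..<n}" t] g_nonneg sums_unique[OF g_sums, of t] by auto
    qed (use int_g int_excess in auto)
    finally show "(\<Sum>m<n. \<integral>t. norm (g m t) \<partial>lborel) \<le> (\<integral>t. indicator {0<..} t * excess_kernel q \<kappa> t \<partial>lborel)" .
  qed simp
  moreover have "AE t in lborel. summable (\<lambda>m. norm (g m t))"
    unfolding norm_g using sums_summable[OF g_sums] by simp
  ultimately have "(\<lambda>m. integral\<^sup>L lborel (g m)) sums (\<integral>t. (\<Sum>m. g m t) \<partial>lborel)"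
    by (intro sums_integral int_g)
  moreover have "(\<Sum>m. g m t) = indicator {0<..} t * excess_kernel q \<kappa> t" for t
    using g_sums by (rule sums_unique[symmetric])
  ultimately show ?thesis
    using g_int by (simp add: excess_integral_def set_lebesgue_integral_def has_bochner_integral_iff)
qed


lemma set_integrable_powr_near_0:
  fixes a c :: real
  assumes "-1 < a" "0 \<le> c"
  shows "set_integrable lborel {0<..c} (\<lambda>t. t powr a)"
  using set_lborel_of_has_integral(1)[OF has_integral_powr_from_0[OF assms]]
  by (rule set_integrable_subset) auto

lemma set_integral_powr_tail:
  fixes q c :: real
  assumes "0 < q" "0 < c"
  shows "set_integrable lborel {c<..} (\<lambda>t. t powr (- q - 1))"
    and "(LINT t:{c<..}|lborel. t powr (- q - 1)) = c powr (- q) / q"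
proof -
  have "((\<lambda>t. t powr (- q - 1)) has_integral (c powr (- q) / q)) {c..}"
    using has_integral_powr_to_inf[of "- q - 1" c] assms by simp
  then have "((\<lambda>t. t powr (- q - 1)) has_integral (c powr (- q) / q)) {c<..}"
    by (subst has_integral_spike_set_eq[where T = "{c..}"]) (auto intro: negligible_subset[of "{c}"])
  from set_lborel_of_has_integral[OF this]
  show "set_integrable lborel {c<..} (\<lambda>t. t powr (- q - 1))"
    and "(LINT t:{c<..}|lborel. t powr (- q - 1)) = c powr (- q) / q"
    by auto
qed

text \<open>Integration by parts with the antiderivative \<open>- (1 - exp (- t)) * t powr (- q) / q\<close>, which
  vanishes at both ends.\<close>

lemma set_integral_one_minus_exp:
  fixes q :: real
  assumes "0 < q" "q < 1"
  shows "set_integrable lborel {0<..} (\<lambda>t. (1 - exp (- t)) * t powr (- q - 1))"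
    and "(LINT t:{0<..}|lborel. (1 - exp (- t)) * t powr (- q - 1)) = Gamma (1 - q) / q"
proof -
  let ?f = "\<lambda>t. (1 - exp (- t)) * t powr (- q - 1)"
  let ?g = "\<lambda>t. t powr ((1 - q) - 1) * exp (- t)"
  have 1: "set_integrable lborel {0<..1} ?f"
  proof (rule set_integrable_bound[OF set_integrable_powr_near_0[of "- q" 1]])
    have "norm (?f t) \<le> norm (t powr (- q))" if "0 < t" for t
    proof -
      have "(1 - exp (- t)) * t powr (- q - 1) \<le> t * t powr (- q - 1)"
        using exp_ge_add_one_self[of "- t"] by (intro mult_right_mono) auto
      also have "\<dots> = t powr (- q)" using that by (simp add: powr_diff)
      finally show ?thesis using that by (simp add: abs_mult)
    qed
    then show "AE t in lborel. t \<in> {0<..1} \<longrightarrow> norm (?f t) \<le> norm (t powr (- q))" by auto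
  qed (use assms in \<open>auto simp: set_borel_measurable_def\<close>)
  have 2: "set_integrable lborel {1<..} ?f"
  proof (rule set_integrable_bound[OF set_integral_powr_tail(1)[of q 1]])
    have "norm (?f t) \<le> norm (t powr (- q - 1))" if "1 < t" for t
      using that mult_right_mono[of "1 - exp (- t)" 1 "t powr (- q - 1)"] by (simp add: abs_mult)
    then show "AE t in lborel. t \<in> {1<..} \<longrightarrow> norm (?f t) \<le> norm (t powr (- q - 1))" by auto
  qed (use assms in \<open>auto simp: set_borel_measurable_def\<close>)
  have "{0::real<..} = {0<..1} \<union> {1<..}" by auto
  then show f: "set_integrable lborel {0<..} ?f"
    using set_integrable_Un[OF 1 2] by simp
  have g: "set_integrable lborel {0<..} ?g" and gG: "(LINT t:{0<..}|lborel. ?g t) = Gamma (1 - q)"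
    using set_integral_Gamma[of "1 - q"] assms by auto
  have "(LBINT t=0..\<infinity>. ?f t - ?g t / q) = 0 - 0"
  proof (rule interval_integral_FTC_integrable[where F = "\<lambda>t. - (1 - exp (- t)) * t powr (- q) / q"])
    fix t :: real assume "0 < ereal t"
    then show "((\<lambda>t. - (1 - exp (- t)) * t powr (- q) / q) has_vector_derivative ?f t - ?g t / q) (at t)"
      using assms
      by (auto simp: has_real_derivative_iff_has_vector_derivative[symmetric] field_simps powr_diff
          intro!: derivative_eq_intros)
    show "isCont (\<lambda>t. ?f t - ?g t / q) t"
      using \<open>0 < ereal t\<close> by (intro continuous_intros) (use assms in auto)
  next
    have "{t. 0 < ereal t \<and> ereal t < \<infinity>} = {0<..}" by auto
    then show "set_integrable lborel (einterval 0 \<infinity>) (\<lambda>t. ?f t - ?g t / q)"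
      using f g by (auto simp: einterval_def)
    show "(((\<lambda>t. - (1 - exp (- t)) * t powr (- q) / q) \<circ> real_of_ereal) \<longlongrightarrow> 0) (at_right 0)"
      using assms unfolding zero_ereal_def ereal_tendsto_simps by real_asymp
    show "(((\<lambda>t. - (1 - exp (- t)) * t powr (- q) / q) \<circ> real_of_ereal) \<longlongrightarrow> 0) (at_left \<infinity>)"
      using assms unfolding ereal_tendsto_simps by real_asymp
  qed auto
  then have "(LINT t:{0<..}|lborel. ?f t - ?g t / q) = 0"
    by (simp add: interval_lebesgue_integral_0_infty)
  moreover have "(LINT t:{0<..}|lborel. ?f t - ?g t / q) = (LINT t:{0<..}|lborel. ?f t) - Gamma (1 - q) / q"
    using f g gG by (subst set_integral_diff) auto
  ultimately show "(LINT t:{0<..}|lborel. ?f t) = Gamma (1 - q) / q" by simp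
qed

section \<open>The exponent\<close>

definition profile_kernel :: "real \<Rightarrow> real \<Rightarrow> real \<Rightarrow> real" where
  "profile_kernel q \<kappa> t = (1 - exp (\<kappa> * sqrt t - t)) * t powr (- q - 1)"

text \<open>Up to a positive factor, the value at \<open>(- K, 1)\<close> of the space-time harmonic function \<open>u\<close> described
  above, for \<open>q = p / 2\<close> and \<open>\<kappa> = sqrt 2 * K\<close>.\<close>

definition profile :: "real \<Rightarrow> real \<Rightarrow> real" where
  "profile q \<kappa> = (LINT t:{0<..}|lborel. profile_kernel q \<kappa> t)"

lemma profile_kernel_measurable [measurable]: "profile_kernel q \<kappa> \<in> borel_measurable borel"
  unfolding profile_kernel_def by measurable

lemma profile_kernel_eq: "profile_kernel q \<kappa> t = (1 - exp (- t)) * t powr (- q - 1) - excess_kernel q \<kappa> t"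
  by (simp add: profile_kernel_def excess_kernel_def algebra_simps exp_diff exp_minus divide_simps)

lemma
  assumes "0 < q" "q < 1/2"
  shows profile_kernel_integrable: "set_integrable lborel {0<..} (profile_kernel q \<kappa>)"
    and profile_eq: "profile q \<kappa> = Gamma (1 - q) / q - excess_integral q \<kappa>"
proof -
  have 1: "set_integrable lborel {0<..} (\<lambda>t. (1 - exp (- t)) * t powr (- q - 1))"
    "(LINT t:{0<..}|lborel. (1 - exp (- t)) * t powr (- q - 1)) = Gamma (1 - q) / q"
    using set_integral_one_minus_exp[of q] assms by auto
  have 2: "set_integrable lborel {0<..} (excess_kernel q \<kappa>)"
    using excess_kernel_integrable assms by auto
  show "set_integrable lborel {0<..} (profile_kernel q \<kappa>)"
    unfolding profile_kernel_eq using 1 2 by (intro set_integral_diff) auto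
  show "profile q \<kappa> = Gamma (1 - q) / q - excess_integral q \<kappa>"
    unfolding profile_def excess_integral_def profile_kernel_eq using 1 2 by (subst set_integral_diff) auto
qed

lemma Gamma_plus1_pos: "0 < z \<Longrightarrow> Gamma (1 + z) = z * Gamma z" for z :: real
proof -
  assume "0 < z"
  then have "z \<notin> \<int>\<^sub>\<le>\<^sub>0" by (auto elim!: nonpos_Ints_cases)
  then show ?thesis using Gamma_plus1[of z] by (simp add: add.commute)
qed

lemma continuous_on_Gamma_pos:
  assumes "continuous_on S f" "\<And>x. x \<in> S \<Longrightarrow> 0 < (f x :: real)"
  shows "continuous_on S (\<lambda>x. Gamma (f x))"
  using assms by (intro continuous_on_compose2[OF continuous_on_Gamma[of "{0<..}"]])
    (auto elim!: nonpos_Ints_cases)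

lemma Gamma_reflection_real:
  assumes "0 < q" "q < (1 :: real)"
  shows "sin (pi * q) * Gamma (1 + q) * (Gamma (1 - q) / q) = pi"
proof -
  have "Gamma (complex_of_real q) * Gamma (1 - complex_of_real q) = of_real pi / sin (of_real pi * of_real q)"
    by (rule Gamma_reflection_complex)
  moreover have "sin (complex_of_real pi * complex_of_real q) = complex_of_real (sin (pi * q))"
    by (simp only: sin_of_real of_real_mult[symmetric])
  ultimately have "complex_of_real (Gamma q * Gamma (1 - q)) = complex_of_real (pi / sin (pi * q))"
    by (simp only: Gamma_complex_of_real[symmetric] of_real_mult of_real_diff of_real_1 of_real_divide)
  then have "Gamma q * Gamma (1 - q) = pi / sin (pi * q)"
    by (simp only: of_real_eq_iff)
  moreover have "0 < sin (pi * q)"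
    using assms by (intro sin_gt_zero) auto
  moreover have "Gamma (1 + q) = q * Gamma q"
    using assms by (simp add: Gamma_plus1_pos)
  ultimately show ?thesis using assms by (simp add: field_simps)
qed

definition exponent_weight :: "real \<Rightarrow> real" where
  "exponent_weight q = sin (pi * q) * Gamma (1 + q) / pi"

lemma exponent_weight_pos:
  assumes "0 < q" "q < 1"
  shows "0 < exponent_weight q"
  using assms by (auto simp: exponent_weight_def intro!: mult_pos_pos divide_pos_pos sin_gt_zero Gamma_real_pos)

lemma exponent_fun_eq_excess_integral:
  assumes "p < 1" "0 \<le> K"
  shows "exponent_fun p K = exponent_weight (p/2) * excess_integral (p/2) (sqrt 2 * K)"
proof -
  have "(\<lambda>m. (sqrt 2 * K) ^ Suc m / fact (Suc m) * Gamma ((real (Suc m) - p) / 2)) sums excess_integral (p/2) (sqrt 2 * K)"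
    using excess_integral_sums[of "p/2" "sqrt 2 * K"] assms by (simp add: diff_divide_distrib)
  then show ?thesis
    by (simp add: exponent_fun_def exponent_weight_def sums_iff Let_def)
qed

text \<open>By the reflection formula the weight is the inverse of \<open>Gamma (1 - q) / q\<close>, the part of the profile
  that does not involve \<open>\<kappa>\<close>.\<close>

lemma exponent_fun_eq_profile:
  assumes "0 < p" "p < 1" "0 \<le> K"
  shows "exponent_fun p K = 1 - exponent_weight (p/2) * profile (p/2) (sqrt 2 * K)"
proof -
  have "exponent_weight (p/2) * (Gamma (1 - p/2) / (p/2)) = 1"
    using Gamma_reflection_real[of "p/2"] assms unfolding exponent_weight_def by (simp add: field_simps)
  then show ?thesis
    using assms by (simp add: exponent_fun_eq_excess_integral profile_eq right_diff_distrib)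
qed

lemma
  assumes "0 < p" "p < 1" "0 \<le> K"
  shows exponent_fun_less_1_iff: "exponent_fun p K < 1 \<longleftrightarrow> 0 < profile (p/2) (sqrt 2 * K)"
    and exponent_fun_eq_1_iff: "exponent_fun p K = 1 \<longleftrightarrow> profile (p/2) (sqrt 2 * K) = 0"
  using exponent_weight_pos[of "p/2"] assms by (auto simp: exponent_fun_eq_profile zero_less_mult_iff)

lemma set_integral_pos:
  fixes f :: "real \<Rightarrow> real"
  assumes f: "set_integrable lborel {0<..} f"
    and nonneg: "\<And>t. 0 < t \<Longrightarrow> 0 \<le> f t" and pos: "\<And>t. 0 < t \<Longrightarrow> t \<noteq> s \<Longrightarrow> 0 < f t"
  shows "0 < (LINT t:{0<..}|lborel. f t)"
proof -
  let ?g = "\<lambda>t. indicator {0<..} t * f t"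
  have g: "integrable lborel ?g" "\<And>t. 0 \<le> ?g t"
    using f nonneg by (auto simp: set_integrable_def indicator_def)
  have "integral\<^sup>L lborel ?g \<noteq> 0"
  proof
    assume "integral\<^sup>L lborel ?g = 0"
    then have "AE t in lborel. ?g t = 0"
      using integral_nonneg_eq_0_iff_AE[OF g(1)] g(2) by simp
    moreover have "AE t in lborel. t \<noteq> s" by (rule AE_lborel_singleton)
    ultimately have "AE t in lborel. t \<notin> {0::real<..}"
      by eventually_elim (use pos in \<open>force simp: indicator_def\<close>)
    then have "emeasure lborel {0::real<..} = 0"
      by (subst (asm) AE_iff_measurable[where N = "{0<..}"]) auto
    moreover have "emeasure lborel {0::real<..1} \<le> emeasure lborel {0::real<..}"
      by (intro emeasure_mono) auto
    ultimately show False by simp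
  qed
  then show ?thesis
    using integral_nonneg_AE[of ?g lborel] g(2) by (simp add: set_lebesgue_integral_def less_le)
qed

lemma profile_strict_antimono_kappa:
  assumes "0 < q" "q < 1/2" "\<kappa> < \<kappa>'"
  shows "profile q \<kappa>' < profile q \<kappa>"
proof -
  have "0 < (LINT t:{0<..}|lborel. profile_kernel q \<kappa> t - profile_kernel q \<kappa>' t)"
  proof (rule set_integral_pos[where s = 0])
    show "0 < profile_kernel q \<kappa> t - profile_kernel q \<kappa>' t" if "0 < t" for t
      using that assms by (simp add: profile_kernel_def)
    then show "0 \<le> profile_kernel q \<kappa> t - profile_kernel q \<kappa>' t" if "0 < t" for t
      using that by (simp add: less_imp_le)
  qed (use assms in \<open>auto intro!: set_integral_diff profile_kernel_integrable\<close>)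
  then show ?thesis
    using assms by (simp add: profile_def set_integral_diff profile_kernel_integrable)
qed

text \<open>The factor \<open>\<kappa>\<^sup>2 powr q\<close> normalises the power of \<open>t\<close> to be \<open>1\<close> at the point \<open>t = \<kappa>\<^sup>2\<close> where
  \<open>1 - exp (\<kappa> * sqrt t - t)\<close> changes sign. Lowering \<open>q\<close> then increases the weight to the right of
  that point and decreases it to the left, and both changes increase the integral.\<close>

lemma profile_scaled_strict_antimono_q:
  assumes "0 < q" "q < q'" "q' < 1/2" "0 < \<kappa>"
  shows "\<kappa>\<^sup>2 powr q' * profile q' \<kappa> < \<kappa>\<^sup>2 powr q * profile q \<kappa>"
proof -
  have "0 < (LINT t:{0<..}|lborel. \<kappa>\<^sup>2 powr q * profile_kernel q \<kappa> t - \<kappa>\<^sup>2 powr q' * profile_kernel q' \<kappa> t)"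
  proof (rule set_integral_pos[where s = "\<kappa>\<^sup>2"])
    fix t :: real assume t: "0 < t"
    have eq: "\<kappa>\<^sup>2 powr q * profile_kernel q \<kappa> t - \<kappa>\<^sup>2 powr q' * profile_kernel q' \<kappa> t =
       (1 - exp (sqrt t * (\<kappa> - sqrt t))) * ((t / \<kappa>\<^sup>2) powr (- q) - (t / \<kappa>\<^sup>2) powr (- q')) / t"
      using t assms by (simp add: profile_kernel_def powr_diff powr_divide powr_minus field_simps)
    have *: "t < \<kappa>\<^sup>2 \<longleftrightarrow> sqrt t < \<kappa>"
      using assms t real_sqrt_less_iff[of t "\<kappa>\<^sup>2"] by simp
    show pos: "0 < \<kappa>\<^sup>2 powr q * profile_kernel q \<kappa> t - \<kappa>\<^sup>2 powr q' * profile_kernel q' \<kappa> t" if "t \<noteq> \<kappa>\<^sup>2"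
    proof (cases "t < \<kappa>\<^sup>2")
      case True
      then have "(t / \<kappa>\<^sup>2) powr (- q) < (t / \<kappa>\<^sup>2) powr (- q')"
        using t assms by (intro powr_less_mono') auto
      moreover have "1 < exp (sqrt t * (\<kappa> - sqrt t))" using * True t by simp
      ultimately show ?thesis unfolding eq using t by (intro divide_pos_pos mult_neg_neg) auto
    next
      case False
      then have "(t / \<kappa>\<^sup>2) powr (- q') < (t / \<kappa>\<^sup>2) powr (- q)"
        using that t assms by (subst powr_less_cancel_iff) (auto simp: less_divide_eq)
      moreover have "\<kappa> < sqrt t" using that t assms False real_sqrt_less_iff[of "\<kappa>\<^sup>2" t] by simp
      ultimately show ?thesis unfolding eq using t by (intro divide_pos_pos mult_pos_pos) (auto simp: mult_less_0_iff)
    qed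
    show "0 \<le> \<kappa>\<^sup>2 powr q * profile_kernel q \<kappa> t - \<kappa>\<^sup>2 powr q' * profile_kernel q' \<kappa> t"
    proof (cases "t = \<kappa>\<^sup>2")
      case True
      then show ?thesis unfolding eq using assms by simp
    qed (use pos in auto)
  qed (use assms in \<open>auto intro!: set_integral_diff set_integrable_mult_right profile_kernel_integrable\<close>)
  then show ?thesis
    using assms by (simp add: profile_def set_integral_diff profile_kernel_integrable)
qed

lemma profile_sign_q:
  assumes "0 < q" "q < q'" "q' < 1/2" "0 < \<kappa>"
  shows "0 \<le> profile q' \<kappa> \<Longrightarrow> 0 < profile q \<kappa>"
proof -
  assume "0 \<le> profile q' \<kappa>"
  then have "0 \<le> \<kappa>\<^sup>2 powr q' * profile q' \<kappa>" by simp
  also note profile_scaled_strict_antimono_q[OF assms]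
  finally show "0 < profile q \<kappa>" using assms by (simp add: zero_less_mult_iff)
qed

lemma exponent_fun_continuous_p:
  assumes "0 \<le> K"
  shows "continuous_on {0..<1} (\<lambda>p. exponent_fun p K)"
proof -
  have "continuous_on {0..<1} (\<lambda>p. exponent_weight (p/2) * excess_integral (p/2) (sqrt 2 * K))"
    unfolding exponent_weight_def
    by (intro continuous_intros continuous_on_Gamma_pos continuous_on_compose2[OF excess_integral_continuous_q])
       (use assms in \<open>auto simp: field_simps\<close>)
  also have "?this \<longleftrightarrow> ?thesis"
    using assms by (intro continuous_on_cong) (auto simp: exponent_fun_eq_excess_integral)
  finally show ?thesis .
qed

lemma exponent_fun_ge:
  assumes "0 < p" "p < 1" "0 \<le> K"
  shows "exponent_weight (p/2) * Gamma (1/2 - p/2) * (sqrt 2 * K) \<le> exponent_fun p K"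
proof -
  let ?g = "\<lambda>m. (sqrt 2 * K) ^ Suc m / fact (Suc m) * Gamma (real (Suc m) / 2 - p/2)"
  have s: "?g sums excess_integral (p/2) (sqrt 2 * K)"
    using assms by (intro excess_integral_sums) auto
  have "0 \<le> ?g m" for m
    using assms by (intro mult_nonneg_nonneg divide_nonneg_nonneg less_imp_le[OF Gamma_real_pos] zero_le_power) (auto simp: field_simps)
  then have "sum ?g {..<1} \<le> suminf ?g"
    by (intro sum_le_suminf sums_summable[OF s]) auto
  then have "(sqrt 2 * K) * Gamma (1/2 - p/2) \<le> excess_integral (p/2) (sqrt 2 * K)"
    using sums_unique[OF s] by simp
  then show ?thesis
    using mult_left_mono[of "(sqrt 2 * K) * Gamma (1/2 - p/2)" _ "exponent_weight (p/2)"]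
      exponent_weight_pos[of "p/2"] assms
    by (simp add: exponent_fun_eq_excess_integral mult_ac)
qed

text \<open>The first term of the series already diverges as \<open>p\<close> tends to \<open>1\<close>, because of the pole of Gamma
  at \<open>0\<close>.\<close>

lemma exponent_fun_gt_1:
  assumes "0 < K"
  obtains p where "0 < p" "p < 1" "1 < exponent_fun p K"
proof -
  define h where "h p = exponent_weight (p/2) * Gamma (3/2 - p/2) * (sqrt 2 * K)" for p
  have "continuous_on {0..1} h"
    unfolding h_def exponent_weight_def
    by (intro continuous_intros continuous_on_Gamma_pos) (auto simp: field_simps)
  then have "(h \<longlongrightarrow> h 1) (at 1 within {0..1})"
    by (auto simp: continuous_on)
  then have "(h \<longlongrightarrow> h 1) (at_left 1)"
    by (simp add: at_within_Icc_at_left)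
  moreover have "0 < h 1"
    unfolding h_def using assms exponent_weight_pos[of "1/2"] by (auto intro!: mult_pos_pos)
  ultimately have "filterlim (\<lambda>p. h p * (1 / (1/2 - p/2))) at_top (at_left 1)"
    by (intro filterlim_tendsto_pos_mult_at_top) (auto, real_asymp)
  then have "eventually (\<lambda>p. 1 < h p * (1 / (1/2 - p/2))) (at_left 1)"
    by (simp add: filterlim_at_top_dense)
  moreover have "eventually (\<lambda>p. p \<in> {0<..<1}) (at_left (1::real))"
    by (rule eventually_at_left_real) simp
  ultimately have "eventually (\<lambda>p. 1 < h p * (1 / (1/2 - p/2)) \<and> p \<in> {0<..<1}) (at_left 1)"
    by (rule eventually_conj)
  then have "\<exists>p. 1 < h p * (1 / (1/2 - p/2)) \<and> p \<in> {0<..<1}"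
    by (rule eventually_happens'[OF trivial_limit_at_left_real])
  then obtain p where p: "1 < h p * (1 / (1/2 - p/2))" "0 < p" "p < 1"
    unfolding greaterThanLessThan_iff by blast
  have "Gamma (3/2 - p/2) = (1/2 - p/2) * Gamma (1/2 - p/2)"
    using Gamma_plus1_pos[of "1/2 - p/2"] p by simp
  then have "h p * (1 / (1/2 - p/2)) \<le> exponent_fun p K"
    using exponent_fun_ge[of p K] p assms by (simp add: h_def mult_ac)
  with p(1) have "1 < exponent_fun p K" by (rule order.strict_trans2)
  with p that show ?thesis by blast
qed

text \<open>The function \<open>exponent_fun p K\<close> vanishes at \<open>p = 0\<close>, where the weight does, and exceeds \<open>1\<close> near
  \<open>p = 1\<close>. Two zeros of the profile in \<open>q\<close> are impossible since it is positive to the left of any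
  zero.\<close>

lemma exponent_ex1:
  assumes "0 < K"
  shows "\<exists>!p. p \<in> {0<..<1} \<and> exponent_fun p K = 1"
proof (rule ex_ex1I)
  obtain p1 where p1: "0 < p1" "p1 < 1" "1 < exponent_fun p1 K"
    using exponent_fun_gt_1[OF assms] by blast
  have "exponent_fun 0 K = 0"
    using assms by (simp add: exponent_fun_eq_excess_integral exponent_weight_def)
  moreover have "continuous_on {0..p1} (\<lambda>p. exponent_fun p K)"
    by (rule continuous_on_subset[OF exponent_fun_continuous_p]) (use assms p1 in auto)
  ultimately obtain p where p: "0 \<le> p" "p \<le> p1" "exponent_fun p K = 1"
    using IVT'[of "\<lambda>p. exponent_fun p K" 0 1 p1] p1 by auto
  then have "p \<noteq> 0" using \<open>exponent_fun 0 K = 0\<close> by auto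
  with p p1 show "\<exists>p. p \<in> {0<..<1} \<and> exponent_fun p K = 1"
    by (intro exI[of _ p]) auto
next
  have *: "\<not> p < p'" if "p \<in> {0<..<1} \<and> exponent_fun p K = 1" "p' \<in> {0<..<1} \<and> exponent_fun p' K = 1" for p p'
    using profile_sign_q[of "p/2" "p'/2" "sqrt 2 * K"] that assms by (auto simp: exponent_fun_eq_1_iff)
  show "p = p'" if "p \<in> {0<..<1} \<and> exponent_fun p K = 1" "p' \<in> {0<..<1} \<and> exponent_fun p' K = 1" for p p'
    using *[OF that] *[OF that(2,1)] by simp
qed

lemma
  assumes "0 < K"
  shows exponent_gt_0: "0 < exponent K" and exponent_lt_1: "exponent K < 1"
    and exponent_fun_exponent: "exponent_fun (exponent K) K = 1"
  using theI'[OF exponent_ex1[OF assms]] unfolding exponent_def by auto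

text \<open>The sign of the profile locates the exponent: the profile is positive to the left of its zero in
  \<open>q\<close> and negative to the right. The remaining properties of the exponent are read off from here.\<close>

lemma exponent_less_iff:
  assumes "0 < K" "0 < p" "p < 1"
  shows "p < exponent K \<longleftrightarrow> 0 < profile (p/2) (sqrt 2 * K)"
proof -
  note E = exponent_gt_0[OF assms(1)] exponent_lt_1[OF assms(1)]
  have 0: "profile (exponent K / 2) (sqrt 2 * K) = 0"
    using exponent_fun_exponent[OF assms(1)] E assms by (simp add: exponent_fun_eq_1_iff)
  then show ?thesis
    using profile_sign_q[of "p/2" "exponent K / 2" "sqrt 2 * K"] profile_sign_q[of "exponent K / 2" "p/2" "sqrt 2 * K"] E assms
    by (cases "p = exponent K") (auto simp: not_less linorder_neq_iff)
qed

lemma exponent_greater_iff: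
  assumes "0 < K" "0 < p" "p < 1"
  shows "exponent K < p \<longleftrightarrow> profile (p/2) (sqrt 2 * K) < 0"
proof -
  have "exponent K = p \<longleftrightarrow> profile (p/2) (sqrt 2 * K) = 0"
    using exponent_ex1[OF assms(1)] exponent_fun_exponent[OF assms(1)] exponent_gt_0[OF assms(1)] exponent_lt_1[OF assms(1)]
      exponent_fun_eq_1_iff[of p K] assms by auto
  then show ?thesis using exponent_less_iff[OF assms] by argo
qed

lemma profile_continuous_kappa:
  assumes "0 < q" "q < 1/2"
  shows "continuous_on UNIV (profile q)"
  using excess_integral_continuous_kappa[of q] assms by (simp add: profile_eq[OF assms, abs_def] continuous_intros)

lemma profile_tendsto:
  assumes "0 < p" "p < 1"
  shows "((\<lambda>K. profile (p/2) (sqrt 2 * K)) \<longlongrightarrow> profile (p/2) (sqrt 2 * K0)) (at K0 within S)"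
  using profile_continuous_kappa[of "p/2"] assms
  by (intro isCont_tendsto_compose[where g = "profile (p/2)"] tendsto_intros)
     (auto simp: continuous_on_eq_continuous_at)

text \<open>The sign of the profile at a fixed \<open>p\<close> on either side of \<open>exponent K0\<close> persists for \<open>K\<close> near \<open>K0\<close>.\<close>

lemma exponent_continuous: "continuous_on {0<..} exponent"
  unfolding continuous_on
proof
  fix K0 :: real assume K0: "K0 \<in> {0<..}"
  note E = exponent_gt_0[of K0] exponent_lt_1[of K0]
  show "(exponent \<longlongrightarrow> exponent K0) (at K0 within {0<..})"
  proof (rule order_tendstoI)
    fix p assume p: "p < exponent K0"
    define p' where "p' = max p (exponent K0 / 2)"
    have p': "0 < p'" "p' < 1" "p' < exponent K0" "p \<le> p'" using E K0 p by (auto simp: p'_def)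
    have "eventually (\<lambda>K. 0 < profile (p'/2) (sqrt 2 * K)) (at K0 within {0<..})"
      using order_tendstoD(1)[OF profile_tendsto[OF p'(1,2)]] exponent_less_iff[of K0 p'] p' K0 by auto
    moreover have "eventually (\<lambda>K. K \<in> {0<..}) (at K0 within {0<..})"
      by (simp add: eventually_at_filter)
    ultimately show "eventually (\<lambda>K. p < exponent K) (at K0 within {0<..})"
      by eventually_elim (use p' exponent_less_iff[of _ p'] in fastforce)
  next
    fix p assume p: "exponent K0 < p"
    define p' where "p' = min p ((exponent K0 + 1) / 2)"
    have p': "0 < p'" "p' < 1" "exponent K0 < p'" "p' \<le> p" using E K0 p by (auto simp: p'_def min_less_iff_disj)
    have "eventually (\<lambda>K. profile (p'/2) (sqrt 2 * K) < 0) (at K0 within {0<..})"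
      using order_tendstoD(2)[OF profile_tendsto[OF p'(1,2)]] exponent_greater_iff[of K0 p'] p' K0 by auto
    moreover have "eventually (\<lambda>K. K \<in> {0<..}) (at K0 within {0<..})"
      by (simp add: eventually_at_filter)
    ultimately show "eventually (\<lambda>K. exponent K < p) (at K0 within {0<..})"
      by eventually_elim (use p' exponent_greater_iff[of _ p'] in fastforce)
  qed
qed

lemma exponent_strict_antimono: "strict_antimono_on {0<..} exponent"
proof (rule monotone_onI)
  fix K K' :: real assume K: "K \<in> {0<..}" "K' \<in> {0<..}" "K < K'"
  note E = exponent_gt_0[of K] exponent_lt_1[of K]
  have "profile (exponent K / 2) (sqrt 2 * K) = 0"
    using exponent_fun_exponent[of K] E K by (simp add: exponent_fun_eq_1_iff)
  then have "profile (exponent K / 2) (sqrt 2 * K') < 0"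
    using profile_strict_antimono_kappa[of "exponent K / 2" "sqrt 2 * K" "sqrt 2 * K'"] E K by auto
  then show "exponent K' < exponent K"
    using exponent_greater_iff[of K' "exponent K"] E K by auto
qed

lemma exponent_at_top: "(exponent \<longlongrightarrow> 0) at_top"
proof (rule order_tendstoI)
  show "eventually (\<lambda>K. a < exponent K) at_top" if "a < 0" for a
    using eventually_gt_at_top[of 0] by eventually_elim (use that exponent_gt_0 in force)
  fix a :: real assume a: "0 < a"
  define p where "p = min a (1/2)"
  have p: "0 < p" "p < 1" "p \<le> a" using a by (auto simp: p_def)
  define c where "c = exponent_weight (p/2) * Gamma (1/2 - p/2)"
  have c: "0 < c" unfolding c_def using p exponent_weight_pos[of "p/2"] by (intro mult_pos_pos Gamma_real_pos) auto
  have "eventually (\<lambda>K. 1 < c * (sqrt 2 * K)) at_top" using c by real_asymp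
  then show "eventually (\<lambda>K. exponent K < a) at_top"
    using eventually_gt_at_top[of 0]
  proof eventually_elim
    case (elim K)
    then have "1 < exponent_fun p K" using exponent_fun_ge[of p K] p by (simp add: c_def)
    then have "profile (p/2) (sqrt 2 * K) < 0"
      using exponent_fun_less_1_iff[of p K] exponent_fun_eq_1_iff[of p K] p elim by force
    then show ?case using exponent_greater_iff[of K p] p elim by auto
  qed
qed

lemma exponent_at_0: "(exponent \<longlongrightarrow> 1) (at_right 0)"
proof (rule order_tendstoI)
  have pos: "eventually (\<lambda>K. 0 < K) (at_right (0::real))" by (simp add: eventually_at_right_less)
  show "eventually (\<lambda>K. exponent K < a) (at_right 0)" if "1 < a" for a
    using pos by eventually_elim (use that exponent_lt_1 in force)
  fix a :: real assume a: "a < 1"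
  define p where "p = max a (1/2)"
  have p: "0 < p" "p < 1" "a \<le> p" using a by (auto simp: p_def)
  have "exponent_fun p 0 < 1"
    by (simp add: exponent_fun_def Let_def)
  then have "0 < profile (p/2) (sqrt 2 * 0)"
    using exponent_fun_less_1_iff[of p 0] p by simp
  from order_tendstoD(1)[OF profile_tendsto[OF p(1,2)] this, of "{0<..}"] pos
  show "eventually (\<lambda>K. a < exponent K) (at_right 0)"
    by eventually_elim (use p exponent_less_iff[of _ p] in fastforce)
qed

section \<open>Random walks above a moving boundary\<close>

text \<open>The condition on the walk during the \<open>k\<close> steps after time \<open>n\<close>, when it is at \<open>x\<close> at that time and goes
  right exactly at the sites satisfying \<open>r\<close>. The recursion runs forward from a variable starting
  point so that the survival probability satisfies a one-step recursion.\<close>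

fun stays_above :: "(nat \<Rightarrow> real) \<Rightarrow> (int \<times> int \<Rightarrow> bool) \<Rightarrow> nat \<Rightarrow> nat \<Rightarrow> int \<Rightarrow> bool" where
  "stays_above h r 0 n x \<longleftrightarrow> h n \<le> x"
| "stays_above h r (Suc k) n x \<longleftrightarrow>
     h n \<le> x \<and> stays_above h r k (Suc n) (if r (x, int n) then x + 1 else x - 1)"

lemma stays_above_measurable:
  assumes "\<And>z. z \<in> Z2even \<Longrightarrow> Measurable.pred M (R z)" "(x, int n) \<in> Z2even"
  shows "Measurable.pred M (\<lambda>\<omega>. stays_above h (\<lambda>z. R z \<omega>) k n x)"
  using assms(2)
proof (induction k arbitrary: n x)
  case (Suc k)
  have [measurable]: "Measurable.pred M (R (x, int n))"
    "Measurable.pred M (\<lambda>\<omega>. stays_above h (\<lambda>z. R z \<omega>) k (Suc n) (x + 1))"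
    "Measurable.pred M (\<lambda>\<omega>. stays_above h (\<lambda>z. R z \<omega>) k (Suc n) (x - 1))"
    using Suc by (auto simp: Z2even_def intro!: assms Suc.IH)
  have eq: "stays_above h (\<lambda>z. R z \<omega>) (Suc k) n x \<longleftrightarrow> h n \<le> x \<and>
     (R (x, int n) \<omega> \<and> stays_above h (\<lambda>z. R z \<omega>) k (Suc n) (x + 1) \<or>
      \<not> R (x, int n) \<omega> \<and> stays_above h (\<lambda>z. R z \<omega>) k (Suc n) (x - 1))" for \<omega>
    by auto
  show ?case unfolding eq by measurable
qed simp

text \<open>A function that dominates the probability of staying above \<open>h\<close> from time \<open>n\<close> to time \<open>N\<close>: it is
  superharmonic for the walk with drift \<open>b\<close>, and it bounds the indicator of the event at time \<open>N\<close>.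
  The margin \<open>1\<close> below \<open>h\<close> covers the site onto which a walk steps when it leaves the region.
  Monotonicity in \<open>x\<close> makes it a majorant for all walks with smaller drift.\<close>

definition survival_majorant :: "(nat \<Rightarrow> real) \<Rightarrow> real \<Rightarrow> nat \<Rightarrow> (nat \<Rightarrow> real \<Rightarrow> real) \<Rightarrow> bool" where
  "survival_majorant h b N V \<longleftrightarrow>
     (\<forall>n x y. x \<le> y \<longrightarrow> V n x \<le> V n y) \<and>
     (\<forall>n x. (1 + b) / 2 * V (Suc n) (x + 1) + (1 - b) / 2 * V (Suc n) (x - 1) \<le> V n x) \<and>
     (\<forall>n\<le>N. \<forall>x. h n - 1 \<le> x \<longrightarrow> 0 \<le> V n x) \<and>
     (\<forall>x. h N - 1 \<le> x \<longrightarrow> 1 \<le> V N x)"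

lemma (in prob_space) prob_cylinder:
  assumes ind: "indep_vars (\<lambda>_. count_space UNIV) R I" and J: "finite J" "J \<subseteq> I"
  shows "prob {\<omega> \<in> space M. \<forall>z\<in>J. R z \<omega> = e z} = (\<Prod>z\<in>J. prob {\<omega> \<in> space M. R z \<omega> = e z})"
proof (cases "J = {}")
  case False
  have "prob (\<Inter>z\<in>J. R z -` {e z} \<inter> space M) = (\<Prod>z\<in>J. prob (R z -` {e z} \<inter> space M))"
    by (rule indep_varsD[OF ind False J]) auto
  also have "(\<Inter>z\<in>J. R z -` {e z} \<inter> space M) = {\<omega> \<in> space M. \<forall>z\<in>J. R z \<omega> = e z}"
    using False by auto
  also have "(\<lambda>z. R z -` {e z} \<inter> space M) = (\<lambda>z. {\<omega> \<in> space M. R z \<omega> = e z})" by auto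
  finally show ?thesis by simp
qed (simp add: prob_space)

lemma (in prob_space) prob_cylinder_insert:
  assumes ind: "indep_vars (\<lambda>_. count_space UNIV) R I" and J: "finite J" "J \<subseteq> I" and z: "z \<in> I" "z \<notin> J"
  shows "prob {\<omega> \<in> space M. \<forall>y\<in>insert z J. R y \<omega> = (e(z := s)) y}
    = prob {\<omega> \<in> space M. R z \<omega> = s} * prob {\<omega> \<in> space M. \<forall>y\<in>J. R y \<omega> = e y}"
proof -
  have "(\<Prod>y\<in>J. prob {\<omega> \<in> space M. R y \<omega> = (e(z := s)) y}) = (\<Prod>y\<in>J. prob {\<omega> \<in> space M. R y \<omega> = e y})"
    using z by (intro prod.cong) auto
  then show ?thesis
    using prob_cylinder[OF ind, of "insert z J" "e(z := s)"] prob_cylinder[OF ind J, of e] J z by simp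
qed

text \<open>Induction on the number of remaining steps. Conditioning on the past is replaced by intersecting
  with a cylinder event of sites at earlier times: revealing the arrow at \<open>(x, n)\<close> merely adds a
  fresh site to the cylinder, whose probability factorises.\<close>

lemma (in prob_space) prob_stays_above_le:
  fixes V :: "nat \<Rightarrow> real \<Rightarrow> real"
  assumes ind: "indep_vars (\<lambda>_. count_space UNIV) R Z2even"
    and right: "\<And>z. z \<in> Z2even \<Longrightarrow> prob {\<omega> \<in> space M. R z \<omega>} \<le> (1 + b) / 2"
    and V: "survival_majorant h b N V"
    and h: "antimono h"
    and J: "finite J" "J \<subseteq> Z2even" "\<And>z. z \<in> J \<Longrightarrow> snd z < int n"
    and n: "n + k = N" "(x, int n) \<in> Z2even" "h n - 1 \<le> x"
  shows "prob {\<omega> \<in> space M. (\<forall>z\<in>J. R z \<omega> = e z) \<and> stays_above h (\<lambda>z. R z \<omega>) k n x}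
    \<le> prob {\<omega> \<in> space M. \<forall>z\<in>J. R z \<omega> = e z} * V n x"
proof -
  have mono: "\<And>n x y. x \<le> y \<Longrightarrow> V n x \<le> V n y"
    and step: "\<And>n x. (1 + b) / 2 * V (Suc n) (x + 1) + (1 - b) / 2 * V (Suc n) (x - 1) \<le> V n x"
    and nonneg: "\<And>n x. n \<le> N \<Longrightarrow> h n - 1 \<le> x \<Longrightarrow> 0 \<le> V n x"
    and one: "\<And>x. h N - 1 \<le> x \<Longrightarrow> 1 \<le> V N x"
    using V by (auto simp: survival_majorant_def)
  show ?thesis
    using J n
  proof (induction k arbitrary: J e n x)
    case 0
    then have N: "n = N" by simp
    have meas: "{\<omega> \<in> space M. \<forall>z\<in>J. R z \<omega> = e z} \<in> events"
    proof (rule sets.sets_Collect_finite_All)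
      show "{\<omega> \<in> space M. R z \<omega> = e z} \<in> events" if "z \<in> J" for z
      proof -
        have [measurable]: "R z \<in> M \<rightarrow>\<^sub>M count_space UNIV"
          using ind that 0 by (auto simp: indep_vars_def)
        show ?thesis by measurable
      qed
    qed fact
    have "prob {\<omega> \<in> space M. (\<forall>z\<in>J. R z \<omega> = e z) \<and> stays_above h (\<lambda>z. R z \<omega>) 0 n x} \<le> prob {\<omega> \<in> space M. \<forall>z\<in>J. R z \<omega> = e z} * 1"
      by (simp, intro finite_measure_mono meas) auto
    also have "\<dots> \<le> prob {\<omega> \<in> space M. \<forall>z\<in>J. R z \<omega> = e z} * V n x"
      using one[of x] 0 N by (intro mult_left_mono) auto
    finally show ?case .
  next
    case (Suc k)
    define z where "z = (x, int n)"
    define P where "P = prob {\<omega> \<in> space M. \<forall>y\<in>J. R y \<omega> = e y}"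
    show ?case
    proof (cases "h n \<le> x")
      case False
      then have "prob {\<omega> \<in> space M. (\<forall>z\<in>J. R z \<omega> = e z) \<and> stays_above h (\<lambda>z. R z \<omega>) (Suc k) n x} = 0"
        by simp
      also have "0 \<le> P * V n x" using nonneg[of n x] Suc by (simp add: P_def)
      finally show ?thesis by (simp add: P_def)
    next
      case True
      have z: "z \<in> Z2even" "z \<notin> J" using Suc.prems(5) Suc.prems(3)[of z] by (auto simp: z_def)
      have R_meas: "Measurable.pred M (R y)" if "y \<in> Z2even" for y
        using ind that by (auto simp: indep_vars_def)
      note [measurable] = R_meas[OF z(1)]
      have even: "(x + 1, int (Suc n)) \<in> Z2even" "(x - 1, int (Suc n)) \<in> Z2even"
        using Suc.prems by (auto simp: Z2even_def)
      have "h (Suc n) \<le> h n" using h by (simp add: antimonoD)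
      have bound: "prob {\<omega> \<in> space M. (\<forall>y\<in>insert z J. R y \<omega> = (e(z := s)) y) \<and> stays_above h (\<lambda>z. R z \<omega>) k (Suc n) x'}
          \<le> prob {\<omega> \<in> space M. R z \<omega> = s} * P * V (Suc n) x'"
        if "x' = x + 1 \<or> x' = x - 1" for s x'
        unfolding P_def prob_cylinder_insert[OF ind Suc.prems(1,2) z, symmetric]
      proof (rule Suc.IH)
        show "snd y < int (Suc n)" if "y \<in> insert z J" for y
          using that Suc.prems(3)[of y] by (auto simp: z_def)
        show "(x', int (Suc n)) \<in> Z2even" using that even by auto
        show "h (Suc n) - 1 \<le> x'" using that True \<open>h (Suc n) \<le> h n\<close> by auto
      qed (use Suc.prems z in auto)
      let ?E = "\<lambda>s x'. {\<omega> \<in> space M. (\<forall>y\<in>insert z J. R y \<omega> = (e(z := s)) y) \<and> stays_above h (\<lambda>z. R z \<omega>) k (Suc n) x'}"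
      have E_meas: "?E s x' \<in> events" if "(x', int (Suc n)) \<in> Z2even" for s x'
      proof (intro sets.sets_Collect_conj sets.sets_Collect_finite_All)
        show "{\<omega> \<in> space M. R y \<omega> = (e(z := s)) y} \<in> events" if "y \<in> insert z J" for y
        proof -
          have [measurable]: "Measurable.pred M (R y)" using that z Suc.prems(2) by (intro R_meas) auto
          show ?thesis by measurable
        qed
        show "{\<omega> \<in> space M. stays_above h (\<lambda>z. R z \<omega>) k (Suc n) x'} \<in> events"
          using stays_above_measurable[OF R_meas that] by simp
      qed (use Suc.prems in auto)
      define p where "p = prob {\<omega> \<in> space M. R z \<omega>}"
      have p': "prob {\<omega> \<in> space M. R z \<omega> = False} = 1 - p"
      proof -
        have "{\<omega> \<in> space M. R z \<omega> = False} = space M - {\<omega> \<in> space M. R z \<omega>}" by auto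
        then show ?thesis by (simp add: p_def prob_compl)
      qed
      have pb: "p \<le> (1 + b) / 2" using right[OF z(1)] by (simp add: p_def)
      have "{\<omega> \<in> space M. (\<forall>z\<in>J. R z \<omega> = e z) \<and> stays_above h (\<lambda>z. R z \<omega>) (Suc k) n x}
          \<subseteq> ?E True (x + 1) \<union> ?E False (x - 1)"
        using z by (auto simp: z_def)
      then have "prob {\<omega> \<in> space M. (\<forall>z\<in>J. R z \<omega> = e z) \<and> stays_above h (\<lambda>z. R z \<omega>) (Suc k) n x}
          \<le> prob (?E True (x + 1) \<union> ?E False (x - 1))"
        by (intro finite_measure_mono sets.Un E_meas even)
      also have "\<dots> \<le> prob (?E True (x + 1)) + prob (?E False (x - 1))"
        by (intro measure_Un_le E_meas even)
      also have "\<dots> \<le> p * P * V (Suc n) (x + 1) + (1 - p) * P * V (Suc n) (x - 1)"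
        using bound[of "x + 1" True] bound[of "x - 1" False] p' by (simp add: p_def)
      also have "\<dots> = P * (V (Suc n) (x - 1) + p * (V (Suc n) (x + 1) - V (Suc n) (x - 1)))"
        by (simp add: algebra_simps)
      \<comment> \<open>Monotonicity of \<open>V\<close> allows the probability of a step to the right to be raised to its bound.\<close>
      also have "\<dots> \<le> P * (V (Suc n) (x - 1) + (1 + b) / 2 * (V (Suc n) (x + 1) - V (Suc n) (x - 1)))"
        using pb mono by (intro mult_left_mono add_left_mono mult_right_mono) (auto simp: P_def)
      also have "\<dots> = P * ((1 + b) / 2 * V (Suc n) (x + 1) + (1 - b) / 2 * V (Suc n) (x - 1))"
        by (simp add: field_simps)
      also have "\<dots> \<le> P * V n x"
        using step[of n x] by (intro mult_left_mono) (auto simp: P_def)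
      finally show ?thesis by (simp add: P_def)
    qed
  qed
qed

text \<open>Two walks at sites of equal parity cannot cross without meeting: while they differ they differ by
  at least \<open>2\<close>, and when they meet the arrows are ordered.\<close>

lemma walk_le_walk:
  assumes \<eta>: "\<And>z. z \<in> Z2even \<Longrightarrow> \<eta> z \<in> {-1, 1}" and \<eta>': "\<And>z. z \<in> Z2even \<Longrightarrow> \<eta>' z \<in> {-1, 1}"
    and le: "\<And>z. z \<in> Z2even \<Longrightarrow> \<eta> z \<le> \<eta>' z"
  shows "walk \<eta> n \<le> walk \<eta>' n \<and> (walk \<eta> n, int n) \<in> Z2even \<and> (walk \<eta>' n, int n) \<in> Z2even"
proof (induction n)
  case (Suc n)
  let ?x = "walk \<eta> n" and ?y = "walk \<eta>' n"
  have xy: "(?x, int n) \<in> Z2even" "(?y, int n) \<in> Z2even" "?x \<le> ?y" using Suc by auto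
  have s: "\<eta> (?x, int n) \<in> {-1, 1}" "\<eta>' (?y, int n) \<in> {-1, 1}"
    using xy \<eta> \<eta>' by auto
  have "?x + \<eta> (?x, int n) \<le> ?y + \<eta>' (?y, int n)"
  proof (cases "?x = ?y")
    case True
    then show ?thesis using le xy by simp
  next
    case False
    have "even (?y - ?x)" using xy by (simp add: Z2even_def)
    with False xy(3) have "?x + 2 \<le> ?y" by presburger
    then show ?thesis using s by auto
  qed
  then show ?case using s xy by (auto simp: Z2even_def)
qed (simp add: Z2even_def)

lemma stays_above_walk:
  fixes h :: "nat \<Rightarrow> real"
  assumes "\<And>j. j \<le> k \<Longrightarrow> h (n + j) \<le> walk (\<lambda>z. if r z then 1 else - 1) (n + j)"
  shows "stays_above h r k n (walk (\<lambda>z. if r z then 1 else - 1) n)"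
  using assms
proof (induction k arbitrary: n)
  case (Suc k)
  have "stays_above h r k (Suc n) (walk (\<lambda>z. if r z then 1 else - 1) (Suc n))"
    by (rule Suc.IH) (use Suc.prems[of "Suc _"] in simp)
  then show ?case using Suc.prems[of 0] by (auto split: if_splits)
qed simp

section \<open>A martingale for the walk with small drift\<close>

lemma cosh_ge_quadratic: "1 + y\<^sup>2 / 2 \<le> cosh y" for y :: real
proof -
  let ?f = "\<lambda>n. if even n then y ^ n /\<^sub>R fact n else 0"
  have "sum ?f {..<3} \<le> suminf ?f"
    by (rule sum_le_suminf) (use cosh_converges[of y] in \<open>auto simp: sums_iff zero_le_even_power\<close>)
  also have "suminf ?f = cosh y"
    using cosh_converges[of y] by (simp add: sums_iff)
  finally show ?thesis by (simp add: eval_nat_numeral)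
qed

text \<open>Expectation of \<open>exp (- y X)\<close> for a \<open>\<plusminus>1\<close> step \<open>X\<close> with mean \<open>b\<close>.\<close>

definition step_mgf :: "real \<Rightarrow> real \<Rightarrow> real" where
  "step_mgf b y = (1 + b) / 2 * exp (- y) + (1 - b) / 2 * exp y"

lemma step_mgf_ge_exp_minus:
  assumes "0 \<le> b" "b \<le> 1" "0 \<le> y"
  shows "exp (- y) \<le> step_mgf b y"
proof -
  have "(1 - b) / 2 * exp (- y) \<le> (1 - b) / 2 * exp y"
    using assms by (intro mult_left_mono) auto
  then show ?thesis by (simp add: step_mgf_def field_simps)
qed

lemma step_mgf_le_exp:
  assumes "0 \<le> b" "b \<le> 1" "0 \<le> y"
  shows "step_mgf b y \<le> exp y"
proof -
  have "(1 + b) / 2 * exp (- y) \<le> (1 + b) / 2 * exp y"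
    using assms by (intro mult_left_mono) auto
  then show ?thesis by (simp add: step_mgf_def field_simps)
qed

lemma step_mgf_pos: "0 \<le> b \<Longrightarrow> b \<le> 1 \<Longrightarrow> 0 \<le> y \<Longrightarrow> 0 < step_mgf b y"
  using step_mgf_ge_exp_minus[of b y] exp_gt_zero[of "- y"] by linarith

text \<open>A drift \<open>b\<close> changes the moment generating function \<open>cosh\<close> of a symmetric step only by a factor
  \<open>exp (4 * b * y)\<close>, which amounts to lowering the boundary by \<open>4 * b\<close> per step.\<close>

lemma cosh_le_step_mgf:
  assumes "0 \<le> b" "0 \<le> y" "4 * b * y \<le> 1"
  shows "cosh y \<le> step_mgf b y * exp (4 * b * y)"
proof -
  have "1 - 2 * y \<le> exp (- (2 * y))" using exp_ge_add_one_self[of "- (2 * y)"] by simp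
  then have "exp y * (1 - 2 * y) \<le> exp y * exp (- (2 * y))" by simp
  then have "exp y - exp (- y) \<le> 2 * y * exp y"
    by (simp add: exp_add[symmetric] algebra_simps)
  also have "\<dots> \<le> 2 * y * (exp y + exp (- y))"
    using assms by (intro mult_left_mono) auto
  finally have s: "sinh y \<le> 2 * y * cosh y" by (simp add: sinh_field_def cosh_field_def)
  have "b * sinh y \<le> b * (2 * y * cosh y)"
    using s assms by (intro mult_left_mono)
  then have m: "(1 - 2 * b * y) * cosh y \<le> step_mgf b y"
    by (simp add: step_mgf_def sinh_field_def cosh_field_def field_simps)
  have "0 \<le> 2 * (b * y) * (1 - 4 * (b * y))" using assms by (intro mult_nonneg_nonneg) auto
  then have "cosh y * 1 \<le> cosh y * ((1 - 2 * b * y) * (1 + 4 * b * y))"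
    by (intro mult_left_mono) (auto simp: algebra_simps)
  also have "\<dots> = ((1 - 2 * b * y) * cosh y) * (1 + 4 * b * y)" by simp
  also have "\<dots> \<le> step_mgf b y * exp (4 * b * y)"
    using assms m exp_ge_add_one_self[of "4 * b * y"]
    by (intro mult_mono order_trans[OF _ m]) auto
  finally show ?thesis by simp
qed

text \<open>With the exact substitution \<open>y = sqrt (2 * t)\<close> this inequality would point the other way. A factor
  \<open>\<rho>\<close> larger than \<open>1\<close> reverses it near \<open>0\<close>; this allows the exact lattice martingale to be compared
  with the Brownian profile at the price of a slightly larger \<open>\<kappa>\<close>.\<close>

lemma exp_le_cosh_sqrt:
  assumes "1 < \<rho>" "0 \<le> t" "t \<le> 1" "t \<le> \<rho>\<^sup>2 - 1"
  shows "exp t \<le> cosh (\<rho> * sqrt (2 * t))"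
proof -
  have "exp t \<le> 1 + t + t\<^sup>2" using exp_bound[of t] assms by simp
  also have "t\<^sup>2 \<le> t * (\<rho>\<^sup>2 - 1)"
    using assms by (simp add: power2_eq_square mult_left_mono)
  then have "1 + t + t\<^sup>2 \<le> 1 + (\<rho> * sqrt (2 * t))\<^sup>2 / 2"
    using assms by (simp add: power_mult_distrib algebra_simps)
  also have "\<dots> \<le> cosh (\<rho> * sqrt (2 * t))" by (rule cosh_ge_quadratic)
  finally show ?thesis .
qed

definition potential_kernel :: "real \<Rightarrow> real \<Rightarrow> real \<Rightarrow> nat \<Rightarrow> real \<Rightarrow> real \<Rightarrow> real" where
  "potential_kernel \<rho> b q n x t =
     (1 - exp (- (\<rho> * sqrt (2 * t)) * x) / step_mgf b (\<rho> * sqrt (2 * t)) ^ n) * t powr (- q - 1)"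

text \<open>The lattice version of \<open>u\<close>: a mixture of the exact martingales \<open>1 - exp (- y * x) / step_mgf b y ^ n\<close>
  of the walk with drift \<open>b\<close>, with \<open>y = \<rho> * sqrt (2 * t)\<close>. The cutoff \<open>T\<close> keeps \<open>y\<close> in the range where
  \<^const>\<open>step_mgf\<close> is comparable with a Gaussian and makes the integral converge for every \<open>x\<close> and \<open>n\<close>.\<close>

definition lattice_potential :: "real \<Rightarrow> real \<Rightarrow> real \<Rightarrow> real \<Rightarrow> nat \<Rightarrow> real \<Rightarrow> real" where
  "lattice_potential \<rho> T b q n x = (LINT t:{0<..T}|lborel. potential_kernel \<rho> b q n x t)"

lemma potential_kernel_measurable [measurable]: "potential_kernel \<rho> b q n x \<in> borel_measurable borel"
  unfolding potential_kernel_def step_mgf_def by measurable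

lemma potential_kernel_step:
  assumes "0 \<le> \<rho>" "0 \<le> b" "b \<le> 1" "0 \<le> t"
  shows "(1 + b) / 2 * potential_kernel \<rho> b q (Suc n) (x + 1) t + (1 - b) / 2 * potential_kernel \<rho> b q (Suc n) (x - 1) t
    = potential_kernel \<rho> b q n x t"
proof -
  define l where "l = \<rho> * sqrt (2 * t)"
  have l: "0 \<le> l" using assms by (simp add: l_def)
  have m: "0 < step_mgf b l" using l assms by (intro step_mgf_pos) auto
  have "(1 + b) / 2 * exp (- l * (x + 1)) + (1 - b) / 2 * exp (- l * (x - 1)) = exp (- l * x) * step_mgf b l"
  proof -
    have "exp (- l * (x + 1)) = exp (- l * x) * exp (- l)" "exp (- l * (x - 1)) = exp (- l * x) * exp l"
      by (simp_all add: exp_add[symmetric] algebra_simps)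
    then show ?thesis by (simp only: step_mgf_def) (simp add: algebra_simps)
  qed
  then have "((1 + b) / 2 * exp (- l * (x + 1)) + (1 - b) / 2 * exp (- l * (x - 1))) / step_mgf b l ^ Suc n = exp (- l * x) / step_mgf b l ^ n"
    using m by simp
  moreover have *: "(1 + b) / 2 * (1 - u) + (1 - b) / 2 * (1 - v) = 1 - ((1 + b) / 2 * u + (1 - b) / 2 * v)" for u v
    by (simp add: field_simps)
  ultimately have "(1 + b) / 2 * (1 - exp (- l * (x + 1)) / step_mgf b l ^ Suc n) + (1 - b) / 2 * (1 - exp (- l * (x - 1)) / step_mgf b l ^ Suc n)
     = 1 - exp (- l * x) / step_mgf b l ^ n"
    unfolding * by (simp only: add_divide_distrib times_divide_eq_right)
  then show ?thesis unfolding potential_kernel_def l_def[symmetric]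
    by (simp only: mult.assoc[symmetric] distrib_right[symmetric])
qed

lemma potential_kernel_mono:
  assumes "0 \<le> \<rho>" "0 \<le> b" "b \<le> 1" "0 \<le> t" "x \<le> y"
  shows "potential_kernel \<rho> b q n x t \<le> potential_kernel \<rho> b q n y t"
proof -
  have "0 < step_mgf b (\<rho> * sqrt (2 * t))" using assms by (intro step_mgf_pos) auto
  moreover have "- (\<rho> * sqrt (2 * t)) * y \<le> - (\<rho> * sqrt (2 * t)) * x"
    using assms by (simp add: mult_left_mono)
  ultimately show ?thesis unfolding potential_kernel_def
    by (intro mult_right_mono diff_left_mono divide_right_mono) auto
qed

text \<open>Since \<^const>\<open>step_mgf\<close> lies between \<open>exp (- y)\<close> and \<open>exp y\<close>, the bracket in the kernel is of
  order \<open>sqrt t\<close> near \<open>0\<close>.\<close>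

lemma potential_kernel_integrable:
  assumes "0 \<le> \<rho>" "0 \<le> b" "b \<le> 1" "0 \<le> T" "q < 1/2"
  shows "set_integrable lborel {0<..T} (potential_kernel \<rho> b q n x)"
proof -
  define A where "A = \<bar>x\<bar> + real n"
  define C where "C = A * (\<rho> * sqrt 2) * exp (A * (\<rho> * sqrt (2 * T)))"
  have int: "set_integrable lborel {0<..T} (\<lambda>t. C * t powr (1/2 - q - 1))"
    using assms by (intro set_integrable_mult_right set_integrable_powr_near_0) auto
  show ?thesis
  proof (rule set_integrable_bound[OF int])
    show "set_borel_measurable lborel {0<..T} (potential_kernel \<rho> b q n x)"
      unfolding set_borel_measurable_def by measurable
    have "norm (potential_kernel \<rho> b q n x t) \<le> norm (C * t powr (1/2 - q - 1))" if t: "0 < t" "t \<le> T" for t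
    proof -
      define l where "l = \<rho> * sqrt (2 * t)"
      have l: "0 \<le> l" using assms t by (simp add: l_def)
      have lT: "l \<le> \<rho> * sqrt (2 * T)" using assms t by (auto simp: l_def intro!: mult_left_mono)
      define E where "E = exp (- l * x) / step_mgf b l ^ n"
      have m: "0 < step_mgf b l" using l assms by (intro step_mgf_pos) auto
      have "ln E = - l * x - n * ln (step_mgf b l)"
        using m by (simp add: E_def ln_div ln_realpow)
      moreover have "\<bar>ln (step_mgf b l)\<bar> \<le> l"
      proof -
        have "ln (step_mgf b l) \<le> ln (exp l)"
          using step_mgf_le_exp[of b l] l assms m by (intro ln_mono) auto
        moreover have "ln (exp (- l)) \<le> ln (step_mgf b l)"
          using step_mgf_ge_exp_minus[of b l] l assms m by (intro ln_mono) auto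
        ultimately show ?thesis by simp
      qed
      then have "\<bar>n * ln (step_mgf b l)\<bar> \<le> n * l" by (simp add: abs_mult mult_left_mono)
      ultimately have lnE: "\<bar>ln E\<bar> \<le> A * l"
        using abs_triangle_ineq4[of "- l * x" "n * ln (step_mgf b l)"] l
        by (simp add: A_def algebra_simps abs_mult)
      have E: "0 < E" using m by (simp add: E_def)
      have "\<bar>1 - E\<bar> = \<bar>exp (ln E) - 1\<bar>"
        using E by (simp add: abs_minus_commute)
      also have "\<dots> \<le> \<bar>ln E\<bar> * exp \<bar>ln E\<bar>" by (rule abs_exp_minus_one_le)
      also have "\<dots> \<le> (A * l) * exp (A * l)"
        using lnE by (intro mult_mono) auto
      also have "\<dots> \<le> (A * l) * exp (A * (\<rho> * sqrt (2 * T)))"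
        using l lT by (intro mult_left_mono) (auto simp: A_def intro!: mult_left_mono)
      also have "\<dots> = C * t powr (1/2)"
        using t by (simp add: C_def l_def real_sqrt_mult powr_half_sqrt)
      finally have "\<bar>1 - E\<bar> * t powr (- q - 1) \<le> (C * t powr (1/2)) * t powr (- q - 1)"
        by (intro mult_right_mono) auto
      then have "norm (potential_kernel \<rho> b q n x t) \<le> C * (t powr (1/2) * t powr (- q - 1))"
        by (simp add: potential_kernel_def abs_mult E_def l_def)
      also have "t powr (1/2) * t powr (- q - 1) = t powr (1/2 - q - 1)"
        by (simp add: powr_add[symmetric])
      finally show ?thesis by simp
    qed
    then show "AE t in lborel. t \<in> {0<..T} \<longrightarrow> norm (potential_kernel \<rho> b q n x t) \<le> norm (C * t powr (1/2 - q - 1))"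
      by auto
  qed
qed

lemma lattice_potential_step:
  assumes "0 \<le> \<rho>" "0 \<le> b" "b \<le> 1" "0 \<le> T" "q < 1/2"
  shows "(1 + b) / 2 * lattice_potential \<rho> T b q (Suc n) (x + 1) + (1 - b) / 2 * lattice_potential \<rho> T b q (Suc n) (x - 1) = lattice_potential \<rho> T b q n x"
proof -
  have "lattice_potential \<rho> T b q n x = (LINT t:{0<..T}|lborel. (1 + b) / 2 * potential_kernel \<rho> b q (Suc n) (x + 1) t + (1 - b) / 2 * potential_kernel \<rho> b q (Suc n) (x - 1) t)"
    unfolding lattice_potential_def
  proof (intro set_lebesgue_integral_cong allI impI)
    fix t assume "t \<in> {0<..T}"
    then show "potential_kernel \<rho> b q n x t = (1 + b) / 2 * potential_kernel \<rho> b q (Suc n) (x + 1) t + (1 - b) / 2 * potential_kernel \<rho> b q (Suc n) (x - 1) t"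
      using assms by (intro potential_kernel_step[symmetric]) auto
  qed auto
  also have "\<dots> = (1 + b) / 2 * lattice_potential \<rho> T b q (Suc n) (x + 1) + (1 - b) / 2 * lattice_potential \<rho> T b q (Suc n) (x - 1)"
    unfolding lattice_potential_def using potential_kernel_integrable[OF assms]
    by (subst set_integral_add) (auto simp del: times_divide_eq_left)
  finally show ?thesis ..
qed

lemma lattice_potential_mono:
  assumes "0 \<le> \<rho>" "0 \<le> b" "b \<le> 1" "0 \<le> T" "q < 1/2" "x \<le> y"
  shows "lattice_potential \<rho> T b q n x \<le> lattice_potential \<rho> T b q n y"
  unfolding lattice_potential_def using assms by (intro set_integral_mono potential_kernel_integrable potential_kernel_mono) auto

lemma lattice_potential_0_le:
  assumes "0 \<le> \<rho>" "0 \<le> b" "b \<le> 1" "0 \<le> T" "q < 1/2"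
  shows "lattice_potential \<rho> T b q n 0 \<le> (LINT t:{0<..T}|lborel. n * \<rho> * sqrt 2 * t powr (1/2 - q - 1))"
  unfolding lattice_potential_def
proof (intro set_integral_mono potential_kernel_integrable)
  fix t :: real assume "t \<in> {0<..T}"
  then have t: "0 < t" by simp
  define l where "l = \<rho> * sqrt (2 * t)"
  have l: "0 \<le> l" using assms t by (simp add: l_def)
  have m: "0 < step_mgf b l" using l assms by (intro step_mgf_pos) auto
  have "1 - n * l \<le> exp (- (n * l))" using exp_ge_add_one_self[of "- (n * l)"] by simp
  also have "\<dots> = 1 / exp l ^ n" by (simp add: exp_minus exp_of_nat_mult inverse_eq_divide)
  also have "\<dots> \<le> 1 / step_mgf b l ^ n"
    using m l assms by (intro divide_left_mono power_mono step_mgf_le_exp) auto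
  finally have "(1 - 1 / step_mgf b l ^ n) * t powr (- q - 1) \<le> (n * l) * t powr (- q - 1)"
    by (intro mult_right_mono) auto
  also have "(n * l) * t powr (- q - 1) = n * \<rho> * sqrt 2 * (t powr (1/2) * t powr (- q - 1))"
    using t by (simp add: l_def powr_half_sqrt real_sqrt_mult)
  also have "t powr (1/2) * t powr (- q - 1) = t powr (1/2 - q - 1)"
    by (simp add: powr_add[symmetric])
  finally show "potential_kernel \<rho> b q n 0 t \<le> n * \<rho> * sqrt 2 * t powr (1/2 - q - 1)"
    by (simp add: potential_kernel_def l_def)
qed (use assms in \<open>auto intro!: set_integrable_mult_right set_integrable_powr_near_0\<close>)

text \<open>Brownian scaling \<open>r = n * t\<close> produces the factor \<open>n powr q\<close>. The discarded part of the profile lies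
  beyond \<open>n * T\<close>, where the integrand is at most \<open>r powr (- q - 1)\<close>.\<close>

lemma profile_rescaled_truncation_ge:
  assumes q: "0 < q" "q < 1/2" and "0 < T" "0 < n"
  shows "set_integrable lborel {0<..T} (\<lambda>t. (1 - exp (\<kappa> * sqrt (n * t) - n * t)) * t powr (- q - 1))"
    and "n powr q * (profile q \<kappa> - (n * T) powr (- q) / q) \<le> (LINT t:{0<..T}|lborel. (1 - exp (\<kappa> * sqrt (n * t) - n * t)) * t powr (- q - 1))"
proof -
  let ?g = "\<lambda>t. (1 - exp (\<kappa> * sqrt (n * t) - n * t)) * t powr (- q - 1)"
  let ?F = "\<lambda>r. indicator {0<..n * T} r * profile_kernel q \<kappa> r"
  have int: "set_integrable lborel {0<..} (profile_kernel q \<kappa>)"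
    by (rule profile_kernel_integrable[OF q])
  have int1: "set_integrable lborel {0<..n * T} (profile_kernel q \<kappa>)"
    and int2: "set_integrable lborel {n * T<..} (profile_kernel q \<kappa>)"
    using assms by (auto intro: set_integrable_subset[OF int] simp: set_eq_iff)
  have eq: "?F (0 + n * t) = n powr (- q - 1) * (indicator {0<..T} t * ?g t)" for t
    using assms by (auto simp: indicator_def profile_kernel_def powr_mult zero_less_mult_iff)
  have "integrable lborel (\<lambda>t. ?F (0 + n * t))"
    using int1 assms by (intro lborel_integrable_real_affine) (auto simp: set_integrable_def)
  then have "integrable lborel (\<lambda>t. n powr (q + 1) * ?F (0 + n * t))" by simp
  moreover have pp: "n powr (q + 1) * n powr (- q - 1) = 1"
    using assms by (simp add: powr_add[symmetric])
  ultimately show "set_integrable lborel {0<..T} ?g"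
    unfolding eq set_integrable_def by (simp add: mult.assoc[symmetric])
  have "(LINT r:{0<..n * T}|lborel. profile_kernel q \<kappa> r) = n * (n powr (- q - 1) * (LINT t:{0<..T}|lborel. ?g t))"
    using lborel_integral_real_affine[of n ?F 0] assms unfolding eq
    by (simp add: set_lebesgue_integral_def)
  also have "\<dots> = n powr (- q) * (LINT t:{0<..T}|lborel. ?g t)"
    using assms by (simp add: powr_diff)
  finally have 1: "(LINT t:{0<..T}|lborel. ?g t) = n powr q * (LINT r:{0<..n * T}|lborel. profile_kernel q \<kappa> r)"
    using assms by (simp add: powr_minus)
  have "{0<..} = {0<..n * T} \<union> {n * T<..}"
    if "0 < n * T" using that by (metis ivl_disj_un_one(5) less_imp_le)
  then have split: "{0<..} = {0<..n * T} \<union> {n * T<..}" using assms by simp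
  have disj: "{0<..n * T} \<inter> {n * T<..} = {}" by auto
  have "profile q \<kappa> = (LINT r:{0<..n * T}|lborel. profile_kernel q \<kappa> r) + (LINT r:{n * T<..}|lborel. profile_kernel q \<kappa> r)"
    unfolding profile_def split by (rule set_integral_Un[OF disj int1 int2])
  also have "(LINT r:{n * T<..}|lborel. profile_kernel q \<kappa> r) \<le> (LINT r:{n * T<..}|lborel. r powr (- q - 1))"
  proof (intro set_integral_mono int2 set_integral_powr_tail)
    show "profile_kernel q \<kappa> r \<le> r powr (- q - 1)" for r
      using mult_right_mono[of "1 - exp (\<kappa> * sqrt r - r)" 1 "r powr (- q - 1)"] by (simp add: profile_kernel_def)
  qed (use assms in auto)
  also have "\<dots> = (n * T) powr (- q) / q"
    using assms by (intro set_integral_powr_tail) auto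
  finally show "n powr q * (profile q \<kappa> - (n * T) powr (- q) / q) \<le> (LINT t:{0<..T}|lborel. ?g t)"
    unfolding 1 using assms by (intro mult_left_mono) auto
qed

text \<open>On and above the boundary the potential is at least of order \<open>n powr q\<close>. Both corrections are
  absorbed into \<open>\<kappa>\<close>: the factor \<open>\<rho>\<close> comes from the lattice, and the drift contributes \<open>4 * \<delta>\<close>, because
  \<open>b * n \<le> \<delta> * sqrt n\<close> as long as \<open>n\<close> is at most of order \<open>1 / b\<^sup>2\<close>.\<close>

lemma lattice_potential_ge:
  assumes q: "0 < q" "q < 1/2" and "1 < \<rho>" "0 < T" "T \<le> 1" "T \<le> \<rho>\<^sup>2 - 1"
    and b: "0 \<le> b" "b \<le> 1" "4 * b * (\<rho> * sqrt (2 * T)) \<le> 1" and n: "0 < n" "b * sqrt n \<le> \<delta>"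
    and x: "- K * sqrt n \<le> x"
    and tail: "(n * T) powr (- q) / q \<le> profile q \<kappa> / 2" and \<kappa>: "\<kappa> = \<rho> * sqrt 2 * (K + 4 * \<delta>)"
  shows "profile q \<kappa> / 2 * n powr q \<le> lattice_potential \<rho> T b q n x"
proof -
  note trunc = profile_rescaled_truncation_ge[OF q \<open>0 < T\<close>, of n \<kappa>]
  have "profile q \<kappa> / 2 * n powr q \<le> n powr q * (profile q \<kappa> - (n * T) powr (- q) / q)"
    using mult_left_mono[OF tail, of "n powr q"] by (simp add: algebra_simps)
  also have "\<dots> \<le> (LINT t:{0<..T}|lborel. (1 - exp (\<kappa> * sqrt (n * t) - n * t)) * t powr (- q - 1))"
    using trunc n by simp
  also have "\<dots> \<le> lattice_potential \<rho> T b q n x"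
    unfolding lattice_potential_def
  proof (intro set_integral_mono potential_kernel_integrable)
    fix t :: real assume "t \<in> {0<..T}"
    then have t: "0 < t" "t \<le> T" by auto
    define l where "l = \<rho> * sqrt (2 * t)"
    have l: "0 \<le> l" using assms t by (simp add: l_def)
    have m: "0 < step_mgf b l" using l assms by (intro step_mgf_pos) auto
    have "4 * b * l \<le> 4 * b * (\<rho> * sqrt (2 * T))"
      unfolding l_def using assms t by (intro mult_left_mono) auto
    then have "exp t \<le> step_mgf b l * exp (4 * b * l)"
      using cosh_le_step_mgf[of b l] exp_le_cosh_sqrt[of \<rho> t] assms t l by (simp add: l_def)
    then have "exp t ^ n \<le> (step_mgf b l * exp (4 * b * l)) ^ n"
      by (intro power_mono) auto
    then have 1: "1 / step_mgf b l ^ n \<le> exp (4 * (n * b) * l - n * t)"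
      using m by (simp add: power_mult_distrib exp_of_nat_mult[symmetric] exp_diff field_simps)
    have "n * b \<le> \<delta> * sqrt n"
    proof -
      have "n * b = (b * sqrt n) * sqrt n" by simp
      also have "\<dots> \<le> \<delta> * sqrt n" using n by (intro mult_right_mono) auto
      finally show ?thesis .
    qed
    then have "4 * (n * b) * l \<le> 4 * (\<delta> * sqrt n) * l" using l by (intro mult_right_mono) auto
    moreover have "- l * x \<le> l * (K * sqrt n)"
      using mult_left_mono[OF x l] by simp
    moreover have "l * (K * sqrt n) + 4 * (\<delta> * sqrt n) * l = \<kappa> * sqrt (n * t)"
      unfolding l_def \<kappa> by (simp add: real_sqrt_mult algebra_simps)
    ultimately have 2: "- l * x + (4 * (n * b) * l - n * t) \<le> \<kappa> * sqrt (n * t) - n * t" by linarith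
    have "exp (- l * x) / step_mgf b l ^ n = exp (- l * x) * (1 / step_mgf b l ^ n)" by simp
    also have "\<dots> \<le> exp (- l * x) * exp (4 * (n * b) * l - n * t)"
      by (intro mult_left_mono 1) auto
    also have "\<dots> \<le> exp (\<kappa> * sqrt (n * t) - n * t)"
      using 2 by (simp add: exp_add[symmetric])
    finally show "(1 - exp (\<kappa> * sqrt (n * t) - n * t)) * t powr (- q - 1) \<le> potential_kernel \<rho> b q n x t"
      unfolding potential_kernel_def l_def by (intro mult_right_mono) auto
  qed (use assms trunc in auto)
  finally show ?thesis .
qed


text \<open>The potential divided by its lower bound at the final time. The final time is chosen of order
  \<open>1 / b\<^sup>2\<close>, which turns the factor \<open>N powr (- q)\<close> into \<open>b powr (2 * q)\<close>.\<close>

lemma survival_majorant_exists: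
  assumes q: "0 < q" "q < 1/2" and K: "0 < K" and pos: "0 < profile q (sqrt 2 * K)"
  obtains C b0 where "0 < C" "0 < b0"
    "\<And>b. 0 < b \<Longrightarrow> b \<le> b0 \<Longrightarrow> \<exists>N V. survival_majorant (\<lambda>n. - K * sqrt n) b N V \<and> V 0 0 \<le> C * b powr (2 * q)"
proof -
  \<comment> \<open>The strict inequality \<open>pos\<close> leaves room \<open>\<delta>\<close> for the lattice correction \<open>\<rho>\<close>, for the drift
    (\<open>4 * \<delta>\<close>) and for the margin of one step below the boundary (\<open>\<delta>\<close>).\<close>
  have "((\<lambda>\<delta>. profile q ((1 + \<delta>) * sqrt 2 * (K + 5 * \<delta>))) \<longlongrightarrow> profile q ((1 + 0) * sqrt 2 * (K + 5 * 0))) (at_right 0)"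
    using profile_continuous_kappa[OF q]
    by (intro isCont_tendsto_compose[where g = "profile q"] tendsto_intros) (auto simp: continuous_on_eq_continuous_at)
  then have "eventually (\<lambda>\<delta>. 0 < profile q ((1 + \<delta>) * sqrt 2 * (K + 5 * \<delta>))) (at_right 0)"
    using pos by (intro order_tendstoD(1)) auto
  moreover have "eventually (\<lambda>\<delta>. 0 < \<delta>) (at_right (0::real))" by (simp add: eventually_at_right_less)
  ultimately have "\<exists>\<delta>. 0 < profile q ((1 + \<delta>) * sqrt 2 * (K + 5 * \<delta>)) \<and> 0 < \<delta>"
    by (intro eventually_happens'[OF trivial_limit_at_right_real] eventually_conj)
  then obtain \<delta> where \<delta>: "0 < profile q ((1 + \<delta>) * sqrt 2 * (K + 5 * \<delta>))" "0 < \<delta>" by blast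
  define \<rho> where "\<rho> = 1 + \<delta>"
  define \<kappa> where "\<kappa> = \<rho> * sqrt 2 * ((K + \<delta>) + 4 * \<delta>)"
  define T where "T = min 1 (\<rho>\<^sup>2 - 1)"
  define c where "c = profile q \<kappa> / 2"
  have c: "0 < c" using \<delta> by (simp add: c_def \<kappa>_def \<rho>_def algebra_simps)
  have \<rho>: "1 < \<rho>" using \<delta> by (simp add: \<rho>_def)
  have T: "0 < T" "T \<le> 1" "T \<le> \<rho>\<^sup>2 - 1" using \<rho> by (auto simp: T_def one_less_power)
  have "((\<lambda>n. (real n * T) powr (- q) / q) \<longlongrightarrow> 0) at_top"
    using T q by real_asymp
  then have "eventually (\<lambda>n. (real n * T) powr (- q) / q < c) at_top"
    using c by (rule order_tendstoD)
  moreover have "eventually (\<lambda>n. 1 \<le> \<delta> * sqrt (real n)) at_top"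
    using \<delta>(2) by real_asymp
  \<comment> \<open>Starting the martingale at time \<open>n1\<close> instead of \<open>0\<close> makes the truncation error small and lets
    \<open>\<delta> * sqrt n1\<close> absorb the step of size \<open>1\<close>.\<close>
  ultimately have "eventually (\<lambda>n. (real n * T) powr (- q) / q < c \<and> 1 \<le> \<delta> * sqrt (real n)) at_top"
    by (rule eventually_conj)
  then obtain n1 :: nat where n1: "(real n1 * T) powr (- q) / q < c" "1 \<le> \<delta> * sqrt n1"
    by (auto simp: eventually_sequentially)
  have n1_pos: "0 < n1" using n1(2) by (cases n1) auto
  define C0 where "C0 = (LINT t:{0<..T}|lborel. n1 * \<rho> * sqrt 2 * t powr (1/2 - q - 1))"
  define C where "C = (\<bar>C0\<bar> + 1) / (c * (\<delta>\<^sup>2 / 2) powr q)"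
  define b0 where "b0 = min (1 / (4 * (\<rho> * sqrt (2 * T)))) (min 1 (\<delta> / sqrt n1))"
  show thesis
  proof (rule that)
    show "0 < C" using c \<delta> by (simp add: C_def)
    show "0 < b0" using \<rho> T \<delta> n1_pos by (auto simp: b0_def)
    fix b :: real assume b: "0 < b" "b \<le> b0"
    have b1: "b \<le> 1" and b2: "4 * b * (\<rho> * sqrt (2 * T)) \<le> 1" and b3: "b * sqrt n1 \<le> \<delta>"
      using b \<rho> T n1_pos by (auto simp: b0_def field_simps)
    \<comment> \<open>The largest \<open>M\<close> with \<open>b * sqrt M \<le> \<delta>\<close>.\<close>
    define M where "M = nat \<lfloor>\<delta>\<^sup>2 / b\<^sup>2\<rfloor>"
    have "n1 \<le> \<delta>\<^sup>2 / b\<^sup>2"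
      using power_mono[OF b3, of 2] b by (simp add: power_mult_distrib field_simps)
    then have M1: "n1 \<le> M" by (simp add: M_def le_nat_floor)
    have M2: "M \<le> \<delta>\<^sup>2 / b\<^sup>2" by (simp add: M_def)
    have M3: "\<delta>\<^sup>2 / b\<^sup>2 \<le> 2 * M" using M1 n1_pos unfolding M_def by linarith
    have sqM: "b * sqrt n \<le> \<delta>" if "n \<le> M" for n
    proof -
      have "real n \<le> (\<delta> / b)\<^sup>2" using that M2 by (simp add: power_divide)
      then have "sqrt n \<le> \<delta> / b" using b \<delta> by (intro real_le_lsqrt) auto
      then show ?thesis using b by (simp add: field_simps)
    qed
    define V where "V n x = lattice_potential \<rho> T b q (n + n1) x / (c * M powr q)" for n x
    define N where "N = M - n1"
    have M: "N + n1 = M" "0 < M" using M1 n1_pos by (auto simp: N_def)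
    have cM: "0 < c * M powr q" using c M by simp
    have potential_ge: "c * (n + n1) powr q \<le> lattice_potential \<rho> T b q (n + n1) x" if "n \<le> N" "- K * sqrt n - 1 \<le> x" for n x
      unfolding c_def
    proof (rule lattice_potential_ge[OF q \<rho> T])
      show "b * sqrt (n + n1) \<le> \<delta>" using sqM[of "n + n1"] that M by simp
      have "K * sqrt n + 1 \<le> K * sqrt (n + n1) + \<delta> * sqrt (n + n1)"
        using K \<delta> by (intro add_mono mult_left_mono order_trans[OF n1(2)]) auto
      then show "- (K + \<delta>) * sqrt (n + n1) \<le> x" using that by (simp add: algebra_simps)
      have "(real (n + n1) * T) powr (- q) \<le> (real n1 * T) powr (- q)"
        using n1_pos T q by (intro powr_mono2') auto
      then have "(real (n + n1) * T) powr (- q) / q \<le> (real n1 * T) powr (- q) / q"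
        using q by (intro divide_right_mono) auto
      then show "(real (n + n1) * T) powr (- q) / q \<le> profile q \<kappa> / 2" using n1(1) unfolding c_def by linarith
    qed (use b b1 b2 n1_pos \<kappa>_def in auto)
    have mono: "V n x \<le> V n y" if "x \<le> y" for n x y
      unfolding V_def using that cM \<rho> b b1 T q by (intro divide_right_mono lattice_potential_mono) auto
    have step: "(1 + b) / 2 * V (Suc n) (x + 1) + (1 - b) / 2 * V (Suc n) (x - 1) \<le> V n x" for n x
      using lattice_potential_step[of \<rho> b T q "n + n1" x] \<rho> b b1 T q
      by (simp add: V_def add_divide_distrib[symmetric])
    have nonneg: "0 \<le> V n x" if "n \<le> N" "- K * sqrt n - 1 \<le> x" for n x
      using order_trans[OF _ potential_ge[OF that]] c cM by (simp add: V_def)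
    have one: "1 \<le> V N x" if "- K * sqrt N - 1 \<le> x" for x
      using potential_ge[OF order_refl that] cM M by (simp add: V_def)
    have "V 0 0 \<le> (\<bar>C0\<bar> + 1) / (c * M powr q)"
      unfolding V_def using lattice_potential_0_le[of \<rho> b T q n1] \<rho> b b1 T q cM
      by (intro divide_right_mono) (auto simp: C0_def)
    also have "\<dots> \<le> (\<bar>C0\<bar> + 1) / (c * ((\<delta>\<^sup>2 / 2) powr q * b powr (- 2 * q)))"
    proof (intro divide_left_mono mult_left_mono)
      have "(\<delta>\<^sup>2 / 2) powr q * b powr (- 2 * q) = ((\<delta>\<^sup>2 / 2) * b powr (- 2)) powr q"
        using b powr_mult[of "\<delta>\<^sup>2 / 2" "b powr (- 2)" q] by (simp add: powr_powr)
      also have "\<dots> \<le> M powr q"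
        using M3 b q by (intro powr_mono2) (auto simp: powr_minus field_simps)
      finally show "(\<delta>\<^sup>2 / 2) powr q * b powr (- 2 * q) \<le> M powr q" .
    qed (use c cM b \<delta> in auto)
    also have "\<dots> = C * b powr (2 * q)"
      using b by (simp add: C_def powr_minus field_simps)
    finally have "V 0 0 \<le> C * b powr (2 * q)" .
    moreover have "survival_majorant (\<lambda>n. - K * sqrt n) b N V"
      unfolding survival_majorant_def using mono step nonneg one by blast
    ultimately show "\<exists>N V. survival_majorant (\<lambda>n. - K * sqrt n) b N V \<and> V 0 0 \<le> C * b powr (2 * q)"
      by blast
  qed
qed

section \<open>Random coverings and Hausdorff measure\<close>

lemma hausdorff_content_le:
  assumes "A \<subseteq> (\<Union>i. U i)" "\<And>i. bounded (U i)" "\<And>i. diameter (U i) \<le> \<delta>"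
  shows "hausdorff_content s \<delta> A \<le> (\<Sum>i. ennreal (diameter (U i) powr s))"
  unfolding hausdorff_content_def by (rule INF_lower) (use assms in auto)

text \<open>For each \<open>m\<close>, consecutive intervals of the lengths \<open>1 / (m + k + 1)\<close>, \<open>k \<ge> 0\<close>, cover the half-line
  because the harmonic series diverges, and they become arbitrarily short as \<open>m\<close> grows. The expected
  sum of the \<open>s\<close>-th powers of the lengths of those that are hit is at most a tail of the convergent
  series of \<open>C * k powr (- (p + s))\<close>.\<close>

lemma (in prob_space) AE_hausdorff_measure_eq_0:
  fixes T :: "'a \<Rightarrow> real set"
  assumes T: "\<And>\<omega>. \<omega> \<in> space M \<Longrightarrow> T \<omega> \<subseteq> {0..}"
    and hit: "\<And>a e. 0 \<le> a \<Longrightarrow> 0 < e \<Longrightarrow> e \<le> e0 \<Longrightarrow>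
      \<exists>E\<in>events. (\<forall>\<omega>\<in>space M. T \<omega> \<inter> {a..a+e} \<noteq> {} \<longrightarrow> \<omega> \<in> E) \<and> prob E \<le> C * e powr p"
    and e0: "0 < e0" and C: "0 \<le> C" and s: "1 < p + s"
  shows "AE \<omega> in M. hausdorff_measure s (T \<omega>) = 0"
proof -
  define \<epsilon> where "\<epsilon> m k = 1 / real (m + k + 1)" for m k :: nat
  define a where "a m k = (\<Sum>j<k. \<epsilon> m j)" for m k
  have \<epsilon>: "0 < \<epsilon> m k" "\<epsilon> m k \<le> 1 / real (Suc m)" for m k
    by (auto simp: \<epsilon>_def field_simps)
  have a_nonneg: "0 \<le> a m k" for m k
    unfolding a_def using \<epsilon> by (intro sum_nonneg) (auto intro: less_imp_le)
  have cover: "\<exists>k. t \<in> {a m k..a m k + \<epsilon> m k}" if "0 \<le> t" for t m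
  proof -
    have "\<not> summable (\<epsilon> m)"
    proof
      assume "summable (\<epsilon> m)"
      then have "summable (\<lambda>k. inverse (real (k + (m + 1))))"
        by (simp add: \<epsilon>_def[abs_def] inverse_eq_divide add_ac)
      then have "summable (\<lambda>k. inverse (real k))" by (subst (asm) summable_iff_shift)
      then show False using not_summable_harmonic by blast
    qed
    then have "\<exists>k. t < a m k"
    proof (rule contrapos_np)
      assume "\<not> (\<exists>k. t < a m k)"
      then show "summable (\<epsilon> m)"
        using \<epsilon> by (intro summableI_nonneg_bounded[of _ t]) (auto simp: a_def not_less less_imp_le)
    qed
    then obtain k where k: "t < a m k" "\<And>j. j < k \<Longrightarrow> \<not> t < a m j"
      using exists_least_iff[of "\<lambda>k. t < a m k"] by blast
    then have "k \<noteq> 0" using that by (auto simp: a_def intro!: Nat.gr0I)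
    then obtain j where "k = Suc j" using not0_implies_Suc by blast
    moreover from this have "a m j \<le> t" using k(2)[of j] by simp
    ultimately show ?thesis using k(1) by (intro exI[of _ j]) (auto simp: a_def)
  qed
  have ex: "\<exists>E. E \<in> events \<and> (\<forall>\<omega>\<in>space M. T \<omega> \<inter> {a m k..a m k + \<epsilon> m k} \<noteq> {} \<longrightarrow> \<omega> \<in> E) \<and> (\<epsilon> m k \<le> e0 \<longrightarrow> prob E \<le> C * \<epsilon> m k powr p)" for m k
  proof (cases "\<epsilon> m k \<le> e0")
    case True
    then show ?thesis using hit[OF a_nonneg \<epsilon>(1), of m k m k] by blast
  qed (auto intro!: exI[of _ "space M"])
  then obtain E where E: "\<And>m k. E m k \<in> events"
    "\<And>m k \<omega>. \<omega> \<in> space M \<Longrightarrow> T \<omega> \<inter> {a m k..a m k + \<epsilon> m k} \<noteq> {} \<Longrightarrow> \<omega> \<in> E m k"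
    "\<And>m k. \<epsilon> m k \<le> e0 \<Longrightarrow> prob (E m k) \<le> C * \<epsilon> m k powr p"
    by metis
  define X where "X m \<omega> = (\<Sum>k. ennreal (\<epsilon> m k powr s) * indicator (E m k) \<omega>)" for m \<omega>
  have X_meas [measurable]: "X m \<in> borel_measurable M" for m
    unfolding X_def using E(1) by measurable
  define g where "g k = C * (1 / real (Suc k)) powr (p + s)" for k
  have "summable (\<lambda>k. real k powr (- (p + s)))" using s by (subst summable_real_powr_iff) auto
  then have "summable (\<lambda>k. real (Suc k) powr (- (p + s)))" by (subst summable_Suc_iff)
  then have g_summable: "summable g"
    unfolding g_def by (intro summable_mult)
      (simp add: powr_divide powr_minus inverse_eq_divide del: minus_add_distrib of_nat_Suc)
  have g_eq: "g (k + m) = C * \<epsilon> m k powr (p + s)" for k m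
    by (simp add: g_def \<epsilon>_def add_ac)
  have EX: "(\<integral>\<^sup>+\<omega>. X m \<omega> \<partial>M) \<le> ennreal (\<Sum>k. g (k + m))" if m: "1 / real (Suc m) \<le> e0" for m
  proof -
    have "(\<integral>\<^sup>+\<omega>. X m \<omega> \<partial>M) = (\<Sum>k. \<integral>\<^sup>+\<omega>. ennreal (\<epsilon> m k powr s) * indicator (E m k) \<omega> \<partial>M)"
      unfolding X_def
      by (rule nn_integral_suminf) (intro borel_measurable_times_ennreal borel_measurable_const borel_measurable_indicator E(1))
    also have "\<dots> = (\<Sum>k. ennreal (\<epsilon> m k powr s) * emeasure M (E m k))"
      using E(1) by (simp add: nn_integral_cmult_indicator)
    also have "\<dots> \<le> (\<Sum>k. ennreal (g (k + m)))"
    proof (intro suminf_le)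
      fix k
      have "\<epsilon> m k \<le> e0" using \<epsilon>(2)[of m k] m by linarith
      then have "\<epsilon> m k powr s * prob (E m k) \<le> \<epsilon> m k powr s * (C * \<epsilon> m k powr p)"
        using E(3) by (intro mult_left_mono) auto
      also have "\<dots> = g (k + m)" by (simp add: g_eq powr_add)
      finally show "ennreal (\<epsilon> m k powr s) * emeasure M (E m k) \<le> ennreal (g (k + m))"
        by (simp add: emeasure_eq_measure ennreal_mult[symmetric] ennreal_leI)
    qed auto
    also have "\<dots> = ennreal (\<Sum>k. g (k + m))"
    proof (rule suminf_ennreal2)
      show "0 \<le> g (k + m)" for k using C by (simp add: g_def)
      show "summable (\<lambda>k. g (k + m))" using g_summable by (subst summable_iff_shift)
    qed
    finally show ?thesis .
  qed
  have tail: "(\<lambda>m. ennreal (\<Sum>k. g (k + m))) \<longlonglongrightarrow> 0"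
    using suminf_exist_split2[OF g_summable] tendsto_ennrealI[of _ 0] by simp
  have Y: "AE \<omega> in M. (INF m\<in>{j..}. X m \<omega>) = 0" for j
  proof -
    have "(\<integral>\<^sup>+\<omega>. (INF m\<in>{j..}. X m \<omega>) \<partial>M) \<le> 0"
    proof (rule tendsto_lowerbound[OF tail])
      have "eventually (\<lambda>m. 1 / real (Suc m) \<le> e0) sequentially"
        using e0 by real_asymp
      then show "eventually (\<lambda>m. (\<integral>\<^sup>+\<omega>. (INF m\<in>{j..}. X m \<omega>) \<partial>M) \<le> ennreal (\<Sum>k. g (k + m))) sequentially"
        using eventually_ge_at_top[of j]
      proof eventually_elim
        case (elim m)
        have "(\<integral>\<^sup>+\<omega>. (INF m\<in>{j..}. X m \<omega>) \<partial>M) \<le> (\<integral>\<^sup>+\<omega>. X m \<omega> \<partial>M)"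
          using elim by (intro nn_integral_mono INF_lower) auto
        also note EX[OF elim(1)]
        finally show ?case .
      qed
    qed simp
    then show ?thesis
      by (subst (asm) le_zero_eq, subst (asm) nn_integral_0_iff_AE) auto
  qed
  then have "AE \<omega> in M. \<forall>j. (INF m\<in>{j..}. X m \<omega>) = 0" by (simp add: AE_all_countable)
  then show ?thesis
    using AE_space
  proof eventually_elim
    case (elim \<omega>)
    have "hausdorff_content s \<delta> (T \<omega>) = 0" if \<delta>: "0 < \<delta>" for \<delta>
    proof -
      obtain j where j: "1 / real (Suc j) < \<delta>" using nat_approx_posE[OF \<delta>] by auto
      have "hausdorff_content s \<delta> (T \<omega>) \<le> X m \<omega>" if m: "j \<le> m" for m
      proof -
        define U where "U k = (if \<omega> \<in> E m k then {a m k..a m k + \<epsilon> m k} else {})" for k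
        have "hausdorff_content s \<delta> (T \<omega>) \<le> (\<Sum>k. ennreal (diameter (U k) powr s))"
        proof (rule hausdorff_content_le)
          show "T \<omega> \<subseteq> (\<Union>k. U k)"
          proof
            fix t assume t: "t \<in> T \<omega>"
            then obtain k where "t \<in> {a m k..a m k + \<epsilon> m k}" using cover[of t m] T elim(2) by auto
            moreover from this have "\<omega> \<in> E m k" using t by (intro E(2)) (use elim(2) in auto)
            ultimately show "t \<in> (\<Union>k. U k)" by (auto simp: U_def)
          qed
          fix k
          show "bounded (U k)" by (simp add: U_def)
          have "\<epsilon> m k \<le> 1 / real (Suc m)" by (rule \<epsilon>)
          also have "\<dots> \<le> 1 / real (Suc j)" using m by (simp add: frac_le)
          finally show "diameter (U k) \<le> \<delta>" using j \<delta> \<epsilon>(1)[of m k] by (simp add: U_def)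
        qed
        also have "\<dots> = X m \<omega>"
        proof -
          have "ennreal (diameter (U k) powr s) = ennreal (\<epsilon> m k powr s) * indicator (E m k) \<omega>" for k
            using \<epsilon>(1)[of m k] by (simp add: U_def indicator_def)
          then show ?thesis by (simp add: X_def)
        qed
        finally show ?thesis .
      qed
      then have "hausdorff_content s \<delta> (T \<omega>) \<le> (INF m\<in>{j..}. X m \<omega>)" by (intro INF_greatest) auto
      then show ?thesis using elim(1) by simp
    qed
    then show ?case by (simp add: hausdorff_measure_def)
  qed
qed

section \<open>Exceptional times of the web\<close>

text \<open>Whether the dominating path for the dynamical time interval \<open>[a, a + e]\<close> goes right at \<open>z\<close>: the
  arrow points right at time \<open>a\<close>, or it may have changed during the interval. This event is larger
  than that of pointing right at some time of the interval, but its probability is easier to bound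
  and still \<open>1/2 + O(e)\<close>.\<close>

definition points_right :: "(int \<times> int \<Rightarrow> nat \<Rightarrow> 'w \<Rightarrow> int) \<Rightarrow> (int \<times> int \<Rightarrow> nat \<Rightarrow> 'w \<Rightarrow> real)
    \<Rightarrow> real \<Rightarrow> real \<Rightarrow> int \<times> int \<Rightarrow> 'w \<Rightarrow> bool" where
  "points_right coin gap a e z \<omega> \<longleftrightarrow> web_xi coin gap a \<omega> z = 1 \<or>
     (\<exists>n\<ge>1. (\<Sum>k<n. gap z k \<omega>) \<in> {a<..a + e})"

lemma web_xi_le_points_right:
  assumes "\<tau> \<in> {a..a + e}" "web_xi coin gap \<tau> \<omega> z = 1"
  shows "points_right coin gap a e z \<omega>"
proof (rule ccontr)
  assume no: "\<not> points_right coin gap a e z \<omega>"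
  have "(\<Sum>k<n. gap z k \<omega>) \<le> \<tau> \<longleftrightarrow> (\<Sum>k<n. gap z k \<omega>) \<le> a" if "1 \<le> n" for n
    using no that assms(1) by (force simp: points_right_def)
  then have "ring_count (\<lambda>k. gap z k \<omega>) \<tau> = ring_count (\<lambda>k. gap z k \<omega>) a"
    unfolding ring_count_def by (intro arg_cong[where f = card]) auto
  then show False using no assms(2) by (simp add: points_right_def web_xi_def)
qed

text \<open>The ring times of a clock form a rate-one Poisson process on the half-line: the densities of the
  successive ring times add up to the constant intensity \<open>1\<close>.\<close>

lemma sum_erlang_density: "(\<Sum>n. ennreal (erlang_density n 1 x)) = indicator {0..} x"
proof (cases "x < 0")
  case False
  have "(\<lambda>n. x ^ n /\<^sub>R fact n * exp (- x)) sums (exp x * exp (- x))"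
    by (intro sums_mult2 exp_converges)
  then have "(\<lambda>n. erlang_density n 1 x) sums 1"
    using False by (simp add: erlang_density_def divide_inverse mult_ac exp_minus)
  then have "(\<Sum>n. ennreal (erlang_density n 1 x)) = ennreal 1"
    by (intro suminf_ennreal_eq) auto
  then show ?thesis using False by simp
qed (simp add: erlang_density_def)

context dynamical_discrete_web
begin

abbreviation "sources \<equiv> case_sum (\<lambda>(z, n) \<omega>. real_of_int (coin z n \<omega>)) (\<lambda>(z, n). gap z n)"

abbreviation "site_sources z \<equiv> ({z} \<times> UNIV) <+> ({z} \<times> (UNIV :: nat set))"

lemma coin_measurable [measurable]: "z \<in> Z2even \<Longrightarrow> (\<lambda>\<omega>. real_of_int (coin z n \<omega>)) \<in> borel_measurable M"
  using indep by (force simp: indep_vars_def)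

lemma gap_measurable [measurable]: "z \<in> Z2even \<Longrightarrow> gap z n \<in> borel_measurable M"
  using indep by (force simp: indep_vars_def)

lemma prob_coin:
  assumes "z \<in> Z2even"
  shows "prob {\<omega> \<in> space M. coin z n \<omega> = 1} = 1/2"
proof -
  have m: "coin z n \<in> M \<rightarrow>\<^sub>M count_space UNIV"
  proof -
    have "(\<lambda>\<omega>. \<lfloor>real_of_int (coin z n \<omega>)\<rfloor>) \<in> M \<rightarrow>\<^sub>M count_space UNIV"
      using assms by measurable
    then show ?thesis by simp
  qed
  have "prob (coin z n -` {1} \<inter> space M) = measure (distr M (count_space UNIV) (coin z n)) {1}"
    using m by (simp add: measure_distr)
  also have "\<dots> = 1/2" by (simp add: coin_law[OF assms] measure_pmf_single)
  also have "coin z n -` {1} \<inter> space M = {\<omega> \<in> space M. coin z n \<omega> = 1}" by auto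
  finally show ?thesis .
qed

lemma ring_count_measurable_PiM:
  "(\<lambda>f. ring_count (\<lambda>k. f (Inr (z, k))) a) \<in> PiM (site_sources z) (\<lambda>_. borel) \<rightarrow>\<^sub>M count_space UNIV"
proof -
  have [measurable]: "(\<lambda>f. f (Inr (z, k))) \<in> borel_measurable (PiM (site_sources z) (\<lambda>_. borel))" for k
    by (rule measurable_component_singleton) auto
  show ?thesis unfolding ring_count_def by measurable
qed

text \<open>The event at \<open>z\<close> is a measurable function of the coins and waiting times at \<open>z\<close>, and these groups
  of variables are independent for different sites.\<close>

lemma indep_points_right:
  "indep_vars (\<lambda>_. count_space UNIV) (points_right coin gap a e) Z2even"
proof -
  let ?F = "\<lambda>z f. f (Inl (z, ring_count (\<lambda>k. f (Inr (z, k))) a)) = (1::real) \<or>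
     (\<exists>n\<ge>1. (\<Sum>k<n. f (Inr (z, k))) \<in> {a<..a + e})"
  have "indep_vars (\<lambda>z. PiM (site_sources z) (\<lambda>_. borel)) (\<lambda>z \<omega>. restrict (\<lambda>i. sources i \<omega>) (site_sources z)) Z2even"
    by (rule indep_vars_restrict[OF indep]) (auto simp: disjoint_family_on_def)
  then have "indep_vars (\<lambda>_. count_space UNIV) (\<lambda>z \<omega>. ?F z (restrict (\<lambda>i. sources i \<omega>) (site_sources z))) Z2even"
  proof (rule indep_vars_compose2)
    fix z :: "int \<times> int"
    have [measurable]: "(\<lambda>f. f (Inr (z, k))) \<in> borel_measurable (PiM (site_sources z) (\<lambda>_. borel))"
      "(\<lambda>f. f (Inl (z, k))) \<in> borel_measurable (PiM (site_sources z) (\<lambda>_. borel))" for k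
      by (rule measurable_component_singleton; auto)+
    have [measurable]: "(\<lambda>f. f (Inl (z, ring_count (\<lambda>k. f (Inr (z, k))) a))) \<in> borel_measurable (PiM (site_sources z) (\<lambda>_. borel))"
      by (rule measurable_compose_countable[OF _ ring_count_measurable_PiM]) measurable
    show "?F z \<in> PiM (site_sources z) (\<lambda>_. borel) \<rightarrow>\<^sub>M count_space UNIV"
      by measurable
  qed
  also have "(\<lambda>z \<omega>. ?F z (restrict (\<lambda>i. sources i \<omega>) (site_sources z))) = points_right coin gap a e"
  proof (intro ext)
    fix z :: "int \<times> int" and \<omega> :: 'w
    have "restrict (\<lambda>i. sources i \<omega>) (site_sources z) (Inl (z, n)) = real_of_int (coin z n \<omega>)"
      "restrict (\<lambda>i. sources i \<omega>) (site_sources z) (Inr (z, n)) = gap z n \<omega>" for n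
      by (simp_all add: InlI InrI)
    then show "?F z (restrict (\<lambda>i. sources i \<omega>) (site_sources z)) = points_right coin gap a e z \<omega>"
      by (simp only: points_right_def web_xi_def of_int_eq_1_iff)
  qed
  finally show ?thesis .
qed

text \<open>Decompose according to the number of rings up to time \<open>a\<close>. It depends on the waiting times only,
  so on each piece the relevant coin is still fair.\<close>

lemma prob_web_xi:
  assumes "z \<in> Z2even"
  shows "{\<omega> \<in> space M. web_xi coin gap a \<omega> z = 1} \<in> events"
    and "prob {\<omega> \<in> space M. web_xi coin gap a \<omega> z = 1} = 1/2"
proof -
  let ?r = "\<lambda>\<omega>. ring_count (\<lambda>k. gap z k \<omega>) a"
  have r [measurable]: "?r \<in> M \<rightarrow>\<^sub>M count_space UNIV"
    unfolding ring_count_def using assms by measurable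
  have ind: "prob {\<omega> \<in> space M. ?r \<omega> = n \<and> coin z n \<omega> = 1} = prob {\<omega> \<in> space M. ?r \<omega> = n} * (1/2)" for n
  proof -
    let ?A = "Inr ` ({z} \<times> UNIV) :: ((int \<times> int) \<times> nat + (int \<times> int) \<times> nat) set"
    let ?B = "{Inl (z, n)} :: ((int \<times> int) \<times> nat + (int \<times> int) \<times> nat) set"
    have "indep_var (PiM ?A (\<lambda>_. borel)) (\<lambda>\<omega>. restrict (\<lambda>i. sources i \<omega>) ?A) (PiM ?B (\<lambda>_. borel)) (\<lambda>\<omega>. restrict (\<lambda>i. sources i \<omega>) ?B)"
      using assms by (intro indep_var_restrict[OF indep]) auto
    then have "indep_var borel ((\<lambda>f. real (ring_count (\<lambda>k. f (Inr (z, k))) a)) \<circ> (\<lambda>\<omega>. restrict (\<lambda>i. sources i \<omega>) ?A))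
       borel ((\<lambda>f. f (Inl (z, n))) \<circ> (\<lambda>\<omega>. restrict (\<lambda>i. sources i \<omega>) ?B))"
    proof (rule indep_var_compose)
      have [measurable]: "(\<lambda>f. f (Inr (z, k))) \<in> borel_measurable (PiM ?A (\<lambda>_. borel))" for k
        by (rule measurable_component_singleton) auto
      have rc: "(\<lambda>f. ring_count (\<lambda>k. f (Inr (z, k))) a) \<in> PiM ?A (\<lambda>_. borel) \<rightarrow>\<^sub>M count_space UNIV"
        unfolding ring_count_def by measurable
      show "(\<lambda>f. real (ring_count (\<lambda>k. f (Inr (z, k))) a)) \<in> borel_measurable (PiM ?A (\<lambda>_. borel))"
        by (rule measurable_compose[OF rc]) simp
    qed (auto intro!: measurable_component_singleton)
    also have "(\<lambda>f. real (ring_count (\<lambda>k. f (Inr (z, k))) a)) \<circ> (\<lambda>\<omega>. restrict (\<lambda>i. sources i \<omega>) ?A) = (\<lambda>\<omega>. real (?r \<omega>))"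
      by (auto simp: fun_eq_iff)
    also have "(\<lambda>f. f (Inl (z, n))) \<circ> (\<lambda>\<omega>. restrict (\<lambda>i. sources i \<omega>) ?B) = (\<lambda>\<omega>. real_of_int (coin z n \<omega>))"
      by (auto simp: fun_eq_iff)
    finally have i: "indep_var borel (\<lambda>\<omega>. real (?r \<omega>)) borel (\<lambda>\<omega>. real_of_int (coin z n \<omega>))" .
    have "prob ((\<lambda>\<omega>. (real (?r \<omega>), real_of_int (coin z n \<omega>))) -` ({real n} \<times> {1}) \<inter> space M) =
      prob ((\<lambda>\<omega>. real (?r \<omega>)) -` {real n} \<inter> space M) * prob ((\<lambda>\<omega>. real_of_int (coin z n \<omega>)) -` {1} \<inter> space M)"
      by (rule indep_varD[OF i]) auto
    also have "(\<lambda>\<omega>. (real (?r \<omega>), real_of_int (coin z n \<omega>))) -` ({real n} \<times> {1}) \<inter> space M = {\<omega> \<in> space M. ?r \<omega> = n \<and> coin z n \<omega> = 1}"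
      by auto
    also have "(\<lambda>\<omega>. real (?r \<omega>)) -` {real n} \<inter> space M = {\<omega> \<in> space M. ?r \<omega> = n}" by auto
    also have "(\<lambda>\<omega>. real_of_int (coin z n \<omega>)) -` {1} \<inter> space M = {\<omega> \<in> space M. coin z n \<omega> = 1}" by auto
    finally show ?thesis by (simp add: prob_coin[OF assms])
  qed
  have [measurable]: "{\<omega> \<in> space M. ?r \<omega> = n \<and> coin z n \<omega> = 1} \<in> events" for n
  proof -
    have "{\<omega> \<in> space M. ?r \<omega> = n \<and> real_of_int (coin z n \<omega>) = 1} \<in> events"
      using assms by measurable
    then show ?thesis by simp
  qed
  have eq: "{\<omega> \<in> space M. web_xi coin gap a \<omega> z = 1} = (\<Union>n. {\<omega> \<in> space M. ?r \<omega> = n \<and> coin z n \<omega> = 1})"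
    by (auto simp: web_xi_def)
  show "{\<omega> \<in> space M. web_xi coin gap a \<omega> z = 1} \<in> events"
    unfolding eq by measurable
  have "(\<lambda>n. prob {\<omega> \<in> space M. ?r \<omega> = n \<and> coin z n \<omega> = 1}) sums prob (\<Union>n. {\<omega> \<in> space M. ?r \<omega> = n \<and> coin z n \<omega> = 1})"
    by (rule finite_measure_UNION) (auto simp: disjoint_family_on_def)
  moreover have "(\<lambda>n. prob {\<omega> \<in> space M. ?r \<omega> = n}) sums prob (\<Union>n. {\<omega> \<in> space M. ?r \<omega> = n})"
    by (rule finite_measure_UNION) (auto simp: disjoint_family_on_def)
  then have "(\<lambda>n. prob {\<omega> \<in> space M. ?r \<omega> = n} * (1/2)) sums (prob (\<Union>n. {\<omega> \<in> space M. ?r \<omega> = n}) * (1/2))"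
    by (rule sums_mult2)
  moreover have "(\<Union>n. {\<omega> \<in> space M. ?r \<omega> = n}) = space M" by auto
  ultimately show "prob {\<omega> \<in> space M. web_xi coin gap a \<omega> z = 1} = 1/2"
    unfolding eq ind by (simp add: prob_space sums_iff)
qed

text \<open>The index set is a set of sources of randomness, not of numbers, so that the independence
  assumption of the locale applies as it stands.\<close>

lemma ring_time_distributed:
  assumes "z \<in> Z2even"
  shows "distributed M lborel (\<lambda>\<omega>. \<Sum>k<Suc n. gap z k \<omega>) (erlang_density n 1)"
proof -
  let ?I = "Inr ` ({z} \<times> {..<Suc n}) :: ((int \<times> int) \<times> nat + (int \<times> int) \<times> nat) set"
  have inj: "inj_on Inr ({z} \<times> {..<Suc n})" by (simp add: inj_on_def)
  have "distributed M lborel (\<lambda>\<omega>. \<Sum>i\<in>?I. sources i \<omega>) (erlang_density (card ?I - 1) 1)"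
  proof (rule exponential_distributed_sum)
    show "indep_vars (\<lambda>i. borel) sources ?I"
      by (rule indep_vars_subset[OF indep]) (use assms in auto)
    show "distributed M lborel (sources i) (exponential_density 1)" if "i \<in> ?I" for i
      using that gap_law[OF assms] by auto
  qed auto
  also have "card ?I - 1 = n" by (simp add: card_image inj)
  also have "(\<lambda>\<omega>. \<Sum>i\<in>?I. sources i \<omega>) = (\<lambda>\<omega>. \<Sum>k<Suc n. gap z k \<omega>)"
    by (simp add: sum.reindex inj sum.cartesian_product' del: sum.lessThan_Suc)
  finally show ?thesis .
qed

text \<open>A union bound over the rings, whose intensity is at most Lebesgue measure.\<close>

lemma prob_ring_le:
  assumes z: "z \<in> Z2even" and e: "0 \<le> e"
  shows "{\<omega> \<in> space M. \<exists>n\<ge>1. (\<Sum>k<n. gap z k \<omega>) \<in> {a<..a + e}} \<in> events"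
    and "prob {\<omega> \<in> space M. \<exists>n\<ge>1. (\<Sum>k<n. gap z k \<omega>) \<in> {a<..a + e}} \<le> e"
proof -
  let ?S = "\<lambda>n \<omega>. \<Sum>k<Suc n. gap z k \<omega>"
  let ?E = "{\<omega> \<in> space M. \<exists>n\<ge>1. (\<Sum>k<n. gap z k \<omega>) \<in> {a<..a + e}}"
  show ev: "?E \<in> events" using z by measurable
  have "?E \<subseteq> (\<Union>n. ?S n -` {a<..a + e} \<inter> space M)"
  proof
    fix \<omega> assume "\<omega> \<in> ?E"
    then obtain n where "1 \<le> n" "(\<Sum>k<n. gap z k \<omega>) \<in> {a<..a + e}" "\<omega> \<in> space M" by auto
    moreover from this obtain m where "n = Suc m" by (cases n) auto
    ultimately show "\<omega> \<in> (\<Union>n. ?S n -` {a<..a + e} \<inter> space M)" by blast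
  qed
  moreover have m [measurable]: "?S n -` {a<..a + e} \<inter> space M \<in> events" for n
    using z by measurable
  ultimately have "emeasure M ?E \<le> emeasure M (\<Union>n. ?S n -` {a<..a + e} \<inter> space M)"
    by (intro emeasure_mono sets.countable_UN) blast+
  also have "\<dots> \<le> (\<Sum>n. emeasure M (?S n -` {a<..a + e} \<inter> space M))"
    using m by (intro emeasure_subadditive_countably) auto
  also have "\<dots> = (\<Sum>n. \<integral>\<^sup>+x. ennreal (erlang_density n 1 x) * indicator {a<..a + e} x \<partial>lborel)"
    using distributed_emeasure[OF ring_time_distributed[OF z], of "{a<..a + e}"] by simp
  also have "\<dots> = (\<integral>\<^sup>+x. (\<Sum>n. ennreal (erlang_density n 1 x) * indicator {a<..a + e} x) \<partial>lborel)"
    by (rule nn_integral_suminf[symmetric]) measurable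
  also have "\<dots> = (\<integral>\<^sup>+x. indicator {0..} x * indicator {a<..a + e} x \<partial>lborel)"
    by (simp add: sum_erlang_density)
  also have "\<dots> \<le> (\<integral>\<^sup>+x. indicator {a<..a + e} x \<partial>lborel)"
    by (intro nn_integral_mono) (auto simp: indicator_def)
  also have "\<dots> = ennreal e" using e by simp
  finally show "prob ?E \<le> e" using e by (simp add: emeasure_eq_measure)
qed

lemma prob_points_right_le:
  assumes "z \<in> Z2even" "0 \<le> e"
  shows "prob {\<omega> \<in> space M. points_right coin gap a e z \<omega>} \<le> (1 + 2 * e) / 2"
proof -
  have "{\<omega> \<in> space M. points_right coin gap a e z \<omega>} = {\<omega> \<in> space M. web_xi coin gap a \<omega> z = 1} \<union>
     {\<omega> \<in> space M. \<exists>n\<ge>1. (\<Sum>k<n. gap z k \<omega>) \<in> {a<..a + e}}"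
    by (auto simp: points_right_def)
  then have "prob {\<omega> \<in> space M. points_right coin gap a e z \<omega>} \<le> prob {\<omega> \<in> space M. web_xi coin gap a \<omega> z = 1} +
     prob {\<omega> \<in> space M. \<exists>n\<ge>1. (\<Sum>k<n. gap z k \<omega>) \<in> {a<..a + e}}"
    using measure_Un_le[OF prob_web_xi(1)[OF assms(1)] prob_ring_le(1)[OF assms]] by simp
  also have "\<dots> \<le> 1/2 + e"
    using prob_web_xi(2)[OF assms(1)] prob_ring_le(2)[OF assms] by (intro add_mono) auto
  finally show ?thesis by simp
qed

lemma web_xi_values: "z \<in> Z2even \<Longrightarrow> \<omega> \<in> space M \<Longrightarrow> web_xi coin gap a \<omega> z \<in> {-1, 1}"
  unfolding web_xi_def by (rule coin_values)

lemma exceptional_time_stays_above: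
  assumes "\<omega> \<in> space M" "\<tau> \<in> exceptional_times coin gap K \<omega>" "\<tau> \<in> {a..a + e}"
  shows "stays_above (\<lambda>n. - K * sqrt n) (\<lambda>z. points_right coin gap a e z \<omega>) N 0 0"
proof -
  let ?\<eta> = "web_xi coin gap \<tau> \<omega>" and ?r = "\<lambda>z. points_right coin gap a e z \<omega>"
  have dom: "walk ?\<eta> j \<le> walk (\<lambda>z. if ?r z then 1 else - 1) j" for j
  proof -
    have "?\<eta> z \<le> (if ?r z then 1 else - 1)" if "z \<in> Z2even" for z
      using web_xi_values[OF that assms(1), of \<tau>] web_xi_le_points_right[OF assms(3), of coin gap \<omega> z] by auto
    then show ?thesis
      using walk_le_walk[of ?\<eta> "\<lambda>z. if ?r z then 1 else - 1" j] web_xi_values[OF _ assms(1), of _ \<tau>] by auto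
  qed
  have "stays_above (\<lambda>n. - K * sqrt n) ?r N 0 (walk (\<lambda>z. if ?r z then 1 else - 1) 0)"
  proof (rule stays_above_walk)
    fix j
    have "- K * sqrt (real j) \<le> walk_path ?\<eta> (real j)"
      using assms(2) by (simp add: exceptional_times_def)
    also have "\<dots> = walk ?\<eta> j" by (simp add: walk_path_def Let_def frac_def)
    also have "\<dots> \<le> walk (\<lambda>z. if ?r z then 1 else - 1) j" using dom by simp
    finally show "- K * sqrt (real (0 + j)) \<le> walk (\<lambda>z. if ?r z then 1 else - 1) (0 + j)" by simp
  qed
  then show ?thesis by simp
qed

text \<open>If the interval contains an exceptional time, the dominating walk stays above the boundary up to
  every time \<open>N\<close>. Its drift is at most \<open>2 * e\<close>, so \<open>survival_majorant_exists\<close> supplies a good \<open>N\<close>.\<close>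

lemma prob_exceptional_time_in_interval_le:
  assumes K: "0 < K" and p: "0 < p" "p < exponent K"
  obtains C e0 where "0 < C" "0 < e0"
    "\<And>a e. 0 < e \<Longrightarrow> e \<le> e0 \<Longrightarrow> \<exists>E\<in>events. (\<forall>\<omega>\<in>space M. exceptional_times coin gap K \<omega> \<inter> {a..a + e} \<noteq> {} \<longrightarrow> \<omega> \<in> E)
       \<and> prob E \<le> C * e powr p"
proof -
  have p1: "p < 1" using p exponent_lt_1[OF K] by simp
  have pos: "0 < profile (p/2) (sqrt 2 * K)" using exponent_less_iff[OF K p(1) p1] p by simp
  from p p1 have q: "0 < p/2" "p/2 < 1/2" by auto
  from survival_majorant_exists[OF q K pos] obtain C b0 where C: "0 < C" "0 < b0"
    and maj: "\<And>b. 0 < b \<Longrightarrow> b \<le> b0 \<Longrightarrow> \<exists>N V. survival_majorant (\<lambda>n. - K * sqrt n) b N V \<and> V 0 0 \<le> C * b powr (2 * (p/2))"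
    by metis
  show thesis
  proof (rule that)
    show "0 < C * 2 powr p" "0 < b0 / 2" using C by auto
    fix a e :: real assume e: "0 < e" "e \<le> b0 / 2"
    then have "0 < 2 * e" "2 * e \<le> b0" by auto
    from maj[OF this] obtain N V where V: "survival_majorant (\<lambda>n. - K * sqrt n) (2 * e) N V"
      and V0: "V 0 0 \<le> C * (2 * e) powr (2 * (p/2))"
      by blast
    let ?R = "points_right coin gap a e"
    let ?E = "{\<omega> \<in> space M. stays_above (\<lambda>n. - K * sqrt n) (\<lambda>z. ?R z \<omega>) N 0 0}"
    have "prob {\<omega> \<in> space M. (\<forall>z\<in>{}. ?R z \<omega> = True) \<and> stays_above (\<lambda>n. - K * sqrt n) (\<lambda>z. ?R z \<omega>) N 0 0}
        \<le> prob {\<omega> \<in> space M. \<forall>z\<in>{}. ?R z \<omega> = True} * V 0 (real_of_int 0)"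
    proof (rule prob_stays_above_le[OF indep_points_right])
      show "antimono (\<lambda>n. - K * sqrt (real n))"
        using K by (intro antimonoI) auto
      show "prob {\<omega> \<in> space M. ?R z \<omega>} \<le> (1 + 2 * e) / 2" if "z \<in> Z2even" for z
        using prob_points_right_le[OF that] e by simp
      show "(0, int 0) \<in> Z2even" by (simp add: Z2even_def)
    qed (use V in auto)
    also have "\<dots> \<le> C * (2 * e) powr p" using V0 by (simp add: prob_space)
    also have "\<dots> = (C * 2 powr p) * e powr p" using e by (simp add: powr_mult)
    finally have "prob ?E \<le> (C * 2 powr p) * e powr p" by simp
    moreover have "?E \<in> events"
    proof -
      have "Measurable.pred M (?R z)" if "z \<in> Z2even" for z
        using indep_points_right[of a e] that by (auto simp: indep_vars_def)
      from stays_above_measurable[OF this, where k = N and n = 0 and x = 0]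
      show ?thesis by (simp add: Z2even_def)
    qed
    ultimately show "\<exists>E\<in>events. (\<forall>\<omega>\<in>space M. exceptional_times coin gap K \<omega> \<inter> {a..a + e} \<noteq> {} \<longrightarrow> \<omega> \<in> E)
       \<and> prob E \<le> C * 2 powr p * e powr p"
      using exceptional_time_stays_above by (intro bexI[of _ ?E]) blast+
  qed
qed

lemma AE_hausdorff_dim_exceptional_times_le:
  assumes K: "0 < K"
  shows "AE \<omega> in M. hausdorff_dim (exceptional_times coin gap K \<omega>) \<le> ereal (1 - exponent K)"
proof -
  note E = exponent_gt_0[OF K] exponent_lt_1[OF K]
  have "AE \<omega> in M. hausdorff_measure (1 - exponent K + 1 / real (Suc i)) (exceptional_times coin gap K \<omega>) = 0" for i
  proof -
    \<comment> \<open>The loss \<open>exponent K - p\<close> must be less than the gain \<open>1 / Suc i\<close> in the dimension, and \<open>p\<close> must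
      be positive.\<close>
    define p where "p = exponent K - exponent K / (2 * real (Suc i))"
    have "exponent K / (2 * real (Suc i)) < 1 / real (Suc i)"
      using divide_strict_right_mono[of "exponent K / 2" 1 "real (Suc i)"] E by (simp del: of_nat_Suc)
    moreover have "exponent K / (2 * real (Suc i)) < exponent K" "0 < exponent K / (2 * real (Suc i))"
      using E by (simp_all add: divide_less_eq)
    ultimately have p: "0 < p" "p < exponent K" "1 < p + (1 - exponent K + 1 / real (Suc i))"
      unfolding p_def by linarith+
    obtain C e0 where "0 < C" "0 < e0"
      "\<And>a e. 0 < e \<Longrightarrow> e \<le> e0 \<Longrightarrow> \<exists>E\<in>events. (\<forall>\<omega>\<in>space M. exceptional_times coin gap K \<omega> \<inter> {a..a + e} \<noteq> {} \<longrightarrow> \<omega> \<in> E)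
       \<and> prob E \<le> C * e powr p"
      using prob_exceptional_time_in_interval_le[OF K p(1,2)] by metis
    then show ?thesis
      using p(3) by (intro AE_hausdorff_measure_eq_0[where C = C and p = p and ?e0.0 = e0]) (auto simp: exceptional_times_def)
  qed
  then have "AE \<omega> in M. \<forall>i. hausdorff_measure (1 - exponent K + 1 / real (Suc i)) (exceptional_times coin gap K \<omega>) = 0"
    by (simp add: AE_all_countable)
  then show ?thesis
  proof eventually_elim
    case (elim \<omega>)
    show ?case
    proof (rule ereal_le_epsilon2)
      fix d :: real assume "0 < d"
      then obtain i where i: "1 / real (Suc i) < d" using nat_approx_posE by auto
      have "0 < 1 - exponent K + 1 / real (Suc i)" using E by (simp add: add_pos_pos)
      then have "hausdorff_dim (exceptional_times coin gap K \<omega>) \<le> ereal (1 - exponent K + 1 / real (Suc i))"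
        unfolding hausdorff_dim_def using elim by (intro INF_lower) auto
      also have "\<dots> \<le> ereal (1 - exponent K) + ereal d" using i by simp
      finally show "hausdorff_dim (exceptional_times coin gap K \<omega>) \<le> ereal (1 - exponent K) + ereal d" .
    qed
  qed
qed

end

theorem proposition5p3:
  fixes M :: "'w measure"
    and coin :: "int \<times> int \<Rightarrow> nat \<Rightarrow> 'w \<Rightarrow> int"
    and gap :: "int \<times> int \<Rightarrow> nat \<Rightarrow> 'w \<Rightarrow> real"
  assumes web: "dynamical_discrete_web M coin gap"
  shows "(\<forall>K>0. \<exists>!p. p \<in> {0<..<1} \<and> exponent_fun p K = 1)
    \<and> (\<forall>K>0. AE \<omega> in M.
          hausdorff_dim (exceptional_times coin gap K \<omega>) \<le> ereal (1 - exponent K))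
    \<and> continuous_on {0<..} exponent
    \<and> strict_antimono_on {0<..} exponent
    \<and> (exponent \<longlongrightarrow> 0) at_top
    \<and> (exponent \<longlongrightarrow> 1) (at_right 0)"
  using exponent_ex1 dynamical_discrete_web.AE_hausdorff_dim_exceptional_times_le[OF web]
    exponent_continuous exponent_strict_antimono exponent_at_top exponent_at_0
  by blast

end
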